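(* Let $\mu \in \mathbb{R}$, $\sigma > 0$, and let $(X_i)_{i \ge 1}$ be i.i.d. random variables following the Cauchy distribution $C(\mu,\sigma)$. Let $\alpha \in \overline{\mathbb{H}}$ and, for $n\ge 1$, let $G_n^{(\alpha)} := \prod_{j=1}^{n} (X_j + \alpha)^{1/n} - \alpha$. Then: (i) If $n \ge 2$, then $G_n^{(\alpha)}$ is an unbiased estimator of $\mu + \sigma i$, i.e. $G_n^{(\alpha)}$ is integrable and $E[G_n^{(\alpha)}] = \mu + \sigma i$. (ii) $\lim_{n\to\infty} G_n^{(\alpha)} = \mu + \sigma i$ almost surely and in $L^p$ for every $0 < p < +\infty$. (iii) \[ \lim_{n \to \infty} n\, \mathrm{Var}\left( G_n^{(\alpha)} \right) = 2 \left((\mu + \mathrm{Re}(\alpha))^2 + (\sigma + \mathrm{Im}(\alpha))^2 \right) \left(\frac{\sigma}{\pi} \int_{\mathbb{R}} \frac{\left(\arccos\left( x/\sqrt{x^2 + \mathrm{Im}(\alpha)^2} \right)\right)^2}{(x - (\mathrm{Re}(\alpha) + \mu))^2 + \sigma^2}\, dx - \theta_{\alpha}^2 \right), \] where \[ \theta_{\alpha} := \arccos\left( \frac{\mu + \mathrm{Re}(\alpha)}{\sqrt{(\mu + \mathrm{Re}(\alpha))^2 + (\sigma + \mathrm{Im}(\alpha))^2}} \right). \]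
   Context: $\overline{\mathbb{H}} = \{x+yi : x\in\mathbb{R},\, y \ge 0\}$. $C(\mu,\sigma)$ is the distribution on $\mathbb{R}$ with density $\frac{\sigma}{\pi}\frac{1}{(x-\mu)^2+\sigma^2}$. For $z = r e^{i\theta}$ with $r>0$ and $-\pi/2 \le \theta < 3\pi/2$, $\log z := \log r + i\theta$; for $p \in \mathbb{R}$, $z^p := \exp(p \log z)$. For a complex-valued random variable $Y$, $E[Y] := E[\mathrm{Re}(Y)] + iE[\mathrm{Im}(Y)]$ and $\mathrm{Var}(Y) := E[|Y - E[Y]|^2]$. Convergence in $L^p$ means $E[|G_n^{(\alpha)} - (\mu+\sigma i)|^p] \to 0$ (the expectation being finite for all sufficiently large $n$). *)

theory Defs
  imports "HOL-Probability.Probability"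
begin

definition cauchy_density :: "real \<Rightarrow> real \<Rightarrow> real \<Rightarrow> real" where
  "cauchy_density \<mu> \<sigma> x = \<sigma> / pi * (1 / ((x - \<mu>)\<^sup>2 + \<sigma>\<^sup>2))"

text \<open>The branch of the argument with values in [-pi/2, 3 pi/2). It is meaningful for nonzero
  arguments only; the library's \<^const>\<open>Ln\<close> uses the range (-pi, pi] and is a different branch.\<close>

definition arg_br :: "complex \<Rightarrow> real" where
  "arg_br z = (THE \<theta>. - pi / 2 \<le> \<theta> \<and> \<theta> < 3 * pi / 2 \<and> is_Arg z \<theta>)"

lemma arg_br_unique:
  assumes "z \<noteq> 0" "- pi / 2 \<le> \<theta>" "\<theta> < 3 * pi / 2" "is_Arg z \<theta>"
  shows "arg_br z = \<theta>"
  unfolding arg_br_def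
proof (rule the_equality)
  fix \<phi> assume "- pi / 2 \<le> \<phi> \<and> \<phi> < 3 * pi / 2 \<and> is_Arg z \<phi>"
  then show "\<phi> = \<theta>"
    using assms is_Arg_eqI[of z \<phi> \<theta>] by (auto simp: abs_less_iff)
qed (use assms in auto)

lemma arg_br_eq_Arg2pi:
  assumes "z \<noteq> 0"
  shows "arg_br z = Arg2pi (\<i> * z) - pi / 2"
proof (rule arg_br_unique)
  have "\<i> * z = of_real (cmod z) * exp (\<i> * of_real (Arg2pi (\<i> * z)))"
    using Arg2pi_eq[of "\<i> * z"] by (simp add: norm_mult)
  then have "z = of_real (cmod z) * exp (\<i> * of_real (Arg2pi (\<i> * z))) * (- \<i>)"
    by (metis (no_types, lifting) mult.commute mult.left_commute complex_i_mult_minus mult_minus_right minus_minus)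
  also have "(- \<i>) = exp (\<i> * of_real (- pi / 2))"
    by (simp add: exp_eq_polar cis_conv_exp[symmetric] complex_eq_iff)
  finally show "is_Arg z (Arg2pi (\<i> * z) - pi / 2)"
    by (simp add: is_Arg_def exp_add[symmetric] mult.assoc algebra_simps)
qed (use assms Arg2pi[of "\<i> * z"] in auto)

definition log_br :: "complex \<Rightarrow> complex" where
  "log_br z = of_real (ln (cmod z)) + \<i> * of_real (arg_br z)"

text \<open>The value at 0, where the logarithm is undefined, is set to 0. For the estimator below it
  matters only on the null event that some \<open>X j + \<alpha>\<close> vanishes.\<close>

definition pow_br :: "complex \<Rightarrow> real \<Rightarrow> complex" where
  "pow_br z p = (if z = 0 then 0 else exp (of_real p * log_br z))"

definition geo_est :: "complex \<Rightarrow> (nat \<Rightarrow> 'a \<Rightarrow> real) \<Rightarrow> nat \<Rightarrow> 'a \<Rightarrow> complex" where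
  "geo_est \<alpha> X n \<omega> = (\<Prod>j=1..n. pow_br (of_real (X j \<omega>) + \<alpha>) (1 / real n)) - \<alpha>"

definition complex_variance :: "'a measure \<Rightarrow> ('a \<Rightarrow> complex) \<Rightarrow> real" where
  "complex_variance M Y = integral\<^sup>L M (\<lambda>\<omega>. (cmod (Y \<omega> - integral\<^sup>L M Y))\<^sup>2)"

definition theta_const :: "real \<Rightarrow> real \<Rightarrow> complex \<Rightarrow> real" where
  "theta_const \<mu> \<sigma> \<alpha> =
     arccos ((\<mu> + Re \<alpha>) / sqrt ((\<mu> + Re \<alpha>)\<^sup>2 + (\<sigma> + Im \<alpha>)\<^sup>2))"

end

theory Submission
  imports Defs "HOL-Complex_Analysis.Complex_Analysis" "HOL-Real_Asymp.Real_Asymp"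
begin

text \<open>
  Write \<open>Y = X + \<alpha>\<close> and \<open>\<beta> = \<mu> + \<sigma> \<i> + \<alpha>\<close>. For \<open>f\<close> holomorphic near the closed upper half-plane and of growth
  \<open>|z|\<^sup>q\<close> with \<open>q < 1\<close>, Cauchy's theorem gives \<open>E[f(X)] = f(\<mu> + \<sigma> \<i>)\<close>; in particular \<open>E[Y\<^sup>p] = \<beta>\<^sup>p\<close>
  for small \<open>p\<close>, which is the unbiasedness. Comparing the second order expansions at \<open>p = 0\<close> yields
  \<open>E[log Y] = log \<beta>\<close> and \<open>E[(log Y)\<^sup>2] = (log \<beta>)\<^sup>2\<close>. The first identity and a strong law for \<open>log Y\<close>, which has
  exponential moments, give almost sure convergence. The absolute moments are explicit,
  \<open>E |G + \<alpha>|\<^sup>q = (E |Y|\<^bsup>q/n\<^esup>)\<^sup>n\<close>, and tend to \<open>|\<beta>|\<^sup>q\<close>; their boundedness upgrades almost sure convergence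
  to \<open>L\<^sup>p\<close>. For \<open>q = 2\<close> the next order term of the expansion is the variance of \<open>log |Y|\<close>, which by the second
  identity equals \<open>E[(arg Y)\<^sup>2] - (arg \<beta>)\<^sup>2\<close>.
\<close>

section \<open>The Cauchy distribution\<close>

text \<open>The Cauchy law has no mean, and for real \<alpha> the branch point 0 lies on the line
  where \<open>Y\<close> lives, so log Y is unbounded at both ends. One integrability fact controls
  both: E[exp(|log Y| / 2)] is finite. At infinity the integrand grows like |x| to the power 1/2,
  below the threshold 1 set by the quadratic decay of the density; near the branch point it is at
  worst of order |x + Re \<alpha>| to the power -1/2, which is locally integrable. This exponent 1/2
  is the origin of the thresholds \<open>n \<ge> 2\<close> for the mean and
  \<open>n \<ge> 2 q\<close> for the absolute moment of order \<open>q\<close>, and of the range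
  \<open>t \<le> 1/4\<close> in the expansions. The chosen branch has its cut along the negative
  imaginary axis, away from the closed upper half-plane, where arguments lie in [0, pi]. The
  logarithm is therefore analytic where Cauchy's theorem is applied. The modulus alone is not
  analytic, so the second moment of log |Y| has no direct formula; the analytic square of log Y
  trades it for the second moment of the argument, which is bounded.\<close>

lemma integrable_one_plus_abs_powr:
  fixes s :: real
  assumes "s < -1"
  shows "integrable lborel (\<lambda>x::real. (1 + \<bar>x\<bar>) powr s)"
proof -
  define f :: "real \<Rightarrow> real" where "f = (\<lambda>x. indicator {1..} x *\<^sub>R x powr s)"
  have [measurable]: "f \<in> borel_measurable borel" unfolding f_def by measurable
  have "(\<lambda>x. x powr s) absolutely_integrable_on {1..}"
    using has_integral_powr_to_inf[OF assms, of 1]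
    by (intro nonnegative_absolutely_integrable_1) (auto simp: integrable_on_def)
  then have "integrable lborel f"
    unfolding set_integrable_def f_def [symmetric] by (subst (asm) integrable_completion) auto
  \<comment> \<open>For every \<open>x\<close> one of the two arguments equals 1 + |x| and
    \<open>f\<close> is nonnegative, so the sum dominates the integrand.\<close>
  then have "integrable lborel (\<lambda>x. f (1 + 1 * x) + f (1 + (-1) * x))"
    by (intro Bochner_Integration.integrable_add lborel_integrable_real_affine) auto
  then show ?thesis
    by (rule Bochner_Integration.integrable_bound) (auto simp: f_def indicator_def)
qed

definition cauchy_measure :: "real \<Rightarrow> real \<Rightarrow> real measure" where
  "cauchy_measure \<mu> \<sigma> = density lborel (\<lambda>x. ennreal (cauchy_density \<mu> \<sigma> x))"

lemma cauchy_density_measurable [measurable]: "cauchy_density \<mu> \<sigma> \<in> borel_measurable borel"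
  unfolding cauchy_density_def[abs_def] by measurable

lemma cauchy_density_nonneg: "\<sigma> > 0 \<Longrightarrow> 0 \<le> cauchy_density \<mu> \<sigma> x"
  by (auto simp: cauchy_density_def)

lemma sets_cauchy_measure [simp, measurable_cong]: "sets (cauchy_measure \<mu> \<sigma>) = sets borel"
  by (simp add: cauchy_measure_def)

lemma space_cauchy_measure [simp]: "space (cauchy_measure \<mu> \<sigma>) = UNIV"
  by (simp add: cauchy_measure_def)

lemma AE_cauchy_measure:
  "AE x in lborel. P x \<Longrightarrow> AE x in cauchy_measure \<mu> \<sigma>. P x"
  unfolding cauchy_measure_def by (subst AE_density) auto

lemma
  fixes f :: "real \<Rightarrow> 'b::{banach, second_countable_topology}"
  assumes "\<sigma> > 0" "f \<in> borel_measurable borel"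
  shows integrable_cauchy_measure:
      "integrable (cauchy_measure \<mu> \<sigma>) f \<longleftrightarrow> integrable lborel (\<lambda>x. cauchy_density \<mu> \<sigma> x *\<^sub>R f x)"
    and integral_cauchy_measure:
      "integral\<^sup>L (cauchy_measure \<mu> \<sigma>) f = (\<integral>x. cauchy_density \<mu> \<sigma> x *\<^sub>R f x \<partial>lborel)"
  unfolding cauchy_measure_def using assms
  by (subst integrable_density integral_density; simp add: cauchy_density_nonneg)+

lemma
  assumes "\<sigma> > 0"
  shows integrable_cauchy_density: "integrable lborel (cauchy_density \<mu> \<sigma>)"
    and integral_cauchy_density: "integral\<^sup>L lborel (cauchy_density \<mu> \<sigma>) = 1"
proof -
  let ?g = "\<lambda>x::real. inverse (1 + x\<^sup>2)"
  have g: "integrable lborel ?g" "integral\<^sup>L lborel ?g = pi"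
    using integrable_inverse_1_plus_square LBINT_inverse_1_plus_square
    by (auto simp: set_integrable_def interval_lebesgue_integral_def set_lebesgue_integral_def)
  have eq: "cauchy_density \<mu> \<sigma> = (\<lambda>x. (1 / (pi * \<sigma>)) * ?g (-\<mu>/\<sigma> + (1/\<sigma>) * x))"
  proof
    fix x
    have "(-\<mu>/\<sigma> + (1/\<sigma>) * x) = (x - \<mu>) / \<sigma>"
      by (simp only: divide_inverse) algebra
    then have "?g (-\<mu>/\<sigma> + (1/\<sigma>) * x) = \<sigma>\<^sup>2 / ((x - \<mu>)\<^sup>2 + \<sigma>\<^sup>2)"
      using assms by (simp add: power_divide field_simps add_nonneg_eq_0_iff)
    then show "cauchy_density \<mu> \<sigma> x = (1 / (pi * \<sigma>)) * ?g (-\<mu>/\<sigma> + (1/\<sigma>) * x)"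
      using assms by (simp add: cauchy_density_def power2_eq_square)
  qed
  show "integrable lborel (cauchy_density \<mu> \<sigma>)"
    unfolding eq using assms
    by (intro integrable_mult_right lborel_integrable_real_affine[OF g(1)]) auto
  define I where "I = (\<integral>x. ?g (-\<mu>/\<sigma> + (1/\<sigma>) * x) \<partial>lborel)"
  have "pi = \<bar>1/\<sigma>\<bar> *\<^sub>R I"
    unfolding I_def
    using assms g(2) by (subst lborel_integral_real_affine[symmetric]) auto
  then show "integral\<^sup>L lborel (cauchy_density \<mu> \<sigma>) = 1"
    unfolding eq integral_mult_right_zero I_def[symmetric] using assms by (auto simp: field_simps)
qed

lemma prob_space_cauchy_measure: "\<sigma> > 0 \<Longrightarrow> prob_space (cauchy_measure \<mu> \<sigma>)"
  by (intro prob_spaceI)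
    (simp add: cauchy_measure_def emeasure_density nn_integral_eq_integral integrable_cauchy_density
      integral_cauchy_density cauchy_density_nonneg)

lemma cauchy_density_le:
  assumes "\<sigma> > 0"
  obtains K where "K \<ge> 0" "\<And>x. cauchy_density \<mu> \<sigma> x \<le> K * (1 + \<bar>x\<bar>) powr (-2)"
proof
  \<comment> \<open>From 1 + |x| \<le> a + b with a = 1 + |\<mu>|, b = |x - \<mu>|, and (a + b)^2
    \<le> 2 a^2 + 2 b^2; the constant 2 a^2 is absorbed by the \<sigma>^2 in the denominator of the
    density.\<close>
  define K where "K = \<sigma> / pi * (2 + 2 * (1 + \<bar>\<mu>\<bar>)\<^sup>2 / \<sigma>\<^sup>2)"
  show "K \<ge> 0" using assms by (simp add: K_def)
  fix x
  have "(1 + \<bar>x\<bar>)\<^sup>2 \<le> ((1 + \<bar>\<mu>\<bar>) + \<bar>x - \<mu>\<bar>)\<^sup>2"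
    by (intro power_mono) auto
  also have "\<dots> \<le> 2 * (1 + \<bar>\<mu>\<bar>)\<^sup>2 + 2 * (x - \<mu>)\<^sup>2"
    using sum_squares_ge_zero[of "(1 + \<bar>\<mu>\<bar>) - \<bar>x - \<mu>\<bar>" 0]
    by (simp add: power2_eq_square algebra_simps)
  also have "\<dots> \<le> (2 + 2 * (1 + \<bar>\<mu>\<bar>)\<^sup>2 / \<sigma>\<^sup>2) * ((x - \<mu>)\<^sup>2 + \<sigma>\<^sup>2)"
    using assms by (simp add: field_simps)
  finally have "(1 + \<bar>x\<bar>)\<^sup>2 \<le> (2 + 2 * (1 + \<bar>\<mu>\<bar>)\<^sup>2 / \<sigma>\<^sup>2) * ((x - \<mu>)\<^sup>2 + \<sigma>\<^sup>2)" .
  moreover have "0 < (x - \<mu>)\<^sup>2 + \<sigma>\<^sup>2" using assms by (simp add: add_nonneg_pos)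
  moreover have "(1 + \<bar>x\<bar>) powr (-2) = 1 / (1 + \<bar>x\<bar>)\<^sup>2"
    by (simp add: powr_minus_divide)
  moreover have "0 < (1 + \<bar>x\<bar>)\<^sup>2"
    by (simp add: add_pos_nonneg)
  moreover have "1 / d \<le> k * (1 / s)" if "s \<le> k * d" "0 < d" "0 < s" for s k d :: real
    using that by (simp add: field_simps)
  ultimately have "1 / ((x - \<mu>)\<^sup>2 + \<sigma>\<^sup>2) \<le> (2 + 2 * (1 + \<bar>\<mu>\<bar>)\<^sup>2 / \<sigma>\<^sup>2) * (1 + \<bar>x\<bar>) powr (-2)"
    by metis
  then show "cauchy_density \<mu> \<sigma> x \<le> K * (1 + \<bar>x\<bar>) powr (-2)"
    unfolding cauchy_density_def K_def mult.assoc using assms by (intro mult_left_mono) auto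
qed

text \<open>The density decays like |x| to the power -2, so the product decays like |x| to the power
  q - 2, and q - 2 < -1. This is where the growth threshold 1 comes from.\<close>

lemma integrable_cauchy_measure_powr_bound:
  fixes f :: "real \<Rightarrow> 'b::{banach, second_countable_topology}"
  assumes "\<sigma> > 0" "q < 1" and [measurable]: "f \<in> borel_measurable borel"
    and f: "\<And>x. norm (f x) \<le> A * (1 + \<bar>x\<bar>) powr q"
  shows "integrable (cauchy_measure \<mu> \<sigma>) f"
proof -
  obtain K where K: "K \<ge> 0" "\<And>x. cauchy_density \<mu> \<sigma> x \<le> K * (1 + \<bar>x\<bar>) powr (-2)"
    using cauchy_density_le[OF assms(1)] by metis
  have "A \<ge> 0" using f[of 0] by simp (metis norm_ge_zero order_trans)
  have "integrable lborel (\<lambda>x. K * A * (1 + \<bar>x\<bar>) powr (q - 2))"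
    using assms by (intro integrable_mult_right integrable_one_plus_abs_powr) auto
  then have "integrable lborel (\<lambda>x. cauchy_density \<mu> \<sigma> x *\<^sub>R f x)"
  proof (rule Bochner_Integration.integrable_bound)
    show "AE x in lborel. norm (cauchy_density \<mu> \<sigma> x *\<^sub>R f x) \<le> norm (K * A * (1 + \<bar>x\<bar>) powr (q - 2))"
    proof (rule AE_I2)
      fix x
      have "norm (cauchy_density \<mu> \<sigma> x *\<^sub>R f x) \<le> (K * (1 + \<bar>x\<bar>) powr (-2)) * (A * (1 + \<bar>x\<bar>) powr q)"
        using K f cauchy_density_nonneg[OF assms(1), of \<mu> x] by (auto intro!: mult_mono)
      also have "\<dots> = K * A * (1 + \<bar>x\<bar>) powr (q - 2)"
        by (simp add: powr_add[symmetric] powr_diff powr_minus divide_simps)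
      finally show "norm (cauchy_density \<mu> \<sigma> x *\<^sub>R f x) \<le> norm (K * A * (1 + \<bar>x\<bar>) powr (q - 2))"
        using K \<open>A \<ge> 0\<close> by simp
    qed
  qed simp
  then show ?thesis using assms by (subst integrable_cauchy_measure) auto
qed

text \<open>The Cauchy density is the Poisson kernel of the upper half-plane at \<mu> + \<sigma> i.
  The contour is the segment from -R to R closed by the upper semicircle, whose contribution
  vanishes because \<open>f\<close> grows more slowly than the first power. The margin
  \<open>e\<close> puts the real axis into an open domain of holomorphy.\<close>

lemma integral_cauchy_measure_holomorphic:
  fixes f :: "complex \<Rightarrow> complex"
  assumes \<sigma>: "\<sigma> > 0" and "e > 0" and hol: "f holomorphic_on {z. Im z > -e}"
    and f: "\<And>z. Im z \<ge> 0 \<Longrightarrow> cmod (f z) \<le> A * (1 + cmod z) powr q" and "q < 1"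
  shows "integral\<^sup>L (cauchy_measure \<mu> \<sigma>) (\<lambda>x. f (of_real x)) = f (Complex \<mu> \<sigma>)"
proof -
  interpret Q: prob_space "cauchy_measure \<mu> \<sigma>"
    by (rule prob_space_cauchy_measure[OF \<sigma>])
  have A: "A \<ge> 0" using f[of 0] by simp (metis norm_ge_zero order_trans)
  define c where "c = Complex \<mu> \<sigma>"
  have c: "Re c = \<mu>" "Im c = \<sigma>" by (auto simp: c_def)
  \<comment> \<open>The minimum with \<sigma> keeps the conjugate of \<open>c\<close>, the remaining
    pole of the kernel, outside \<open>S\<close>; a half-plane is convex, as the form of Cauchy's
    theorem used below requires.\<close>
  define S where "S = {z. Im z > - min e \<sigma>}"
  have "open S" "convex S"
    unfolding S_def by (auto intro!: open_halfspace_Im_gt convex_halfspace_Im_gt)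
  have holS: "f holomorphic_on S"
    by (rule holomorphic_on_subset[OF hol]) (auto simp: S_def)
  \<comment> \<open>Subtracting \<open>f c\<close> removes the pole of \<open>f\<close> times the density at \<open>c\<close>, so that no residue is needed.\<close>
  define g where "g z = (if z = c then deriv f c else (f z - f c) / (z - c)) / (z - cnj c)" for z
  have cnjc: "z \<noteq> cnj c" if "z \<in> S" for z using that c \<sigma> by (auto simp: S_def)
  have hg: "g holomorphic_on S"
    unfolding g_def[abs_def] using cnjc
    by (intro holomorphic_on_divide pole_lemma_open holS \<open>open S\<close> holomorphic_intros) auto
  have contg: "continuous_on UNIV (\<lambda>x::real. g (of_real x))"
    using holomorphic_on_imp_continuous_on[OF hg]
    by (rule continuous_on_compose2) (use \<sigma> \<open>e > 0\<close> in \<open>auto simp: S_def intro!: continuous_intros\<close>)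
  have contf: "continuous_on UNIV (\<lambda>x::real. f (of_real x))"
    using holomorphic_on_imp_continuous_on[OF holS]
    by (rule continuous_on_compose2) (use \<sigma> \<open>e > 0\<close> in \<open>auto simp: S_def intro!: continuous_intros\<close>)
  have [measurable]: "(\<lambda>x::real. g (of_real x)) \<in> borel_measurable borel"
      "(\<lambda>x::real. f (of_real x)) \<in> borel_measurable borel"
    using contg contf by (auto intro: borel_measurable_continuous_onI)
  have intf: "integrable (cauchy_measure \<mu> \<sigma>) (\<lambda>x. f (of_real x))"
    by (rule integrable_cauchy_measure_powr_bound[OF \<sigma> \<open>q < 1\<close>, where A=A])
      (use f[of "of_real _"] in auto)
  \<comment> \<open>For real \<open>x\<close> the product of \<open>x - c\<close> and
    \<open>x - cnj c\<close> is the denominator of the density, so integrating \<open>g\<close> over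
    the line computes the mean of f(X) - f(c).\<close>
  have g_real: "(\<sigma> / pi) *\<^sub>R g (of_real x) = cauchy_density \<mu> \<sigma> x *\<^sub>R (f (of_real x) - f c)" for x :: real
  proof -
    define d where "d = (x - \<mu>)\<^sup>2 + \<sigma>\<^sup>2"
    have "(of_real x - c) * (of_real x - cnj c) = of_real d"
      by (simp add: complex_eq_iff c power2_eq_square algebra_simps d_def)
    moreover have "of_real x \<noteq> c" using c \<sigma> by auto
    ultimately have "g (of_real x) = (f (of_real x) - f c) / of_real d"
      by (simp add: g_def)
    then show ?thesis
      by (simp add: cauchy_density_def flip: d_def) (simp add: scaleR_conv_of_real)
  qed
  have "integrable lborel (\<lambda>x. cauchy_density \<mu> \<sigma> x *\<^sub>R (f (of_real x) - f c))"
    using intf \<sigma> by (subst integrable_cauchy_measure[symmetric]) auto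
  then have "integrable lborel (\<lambda>x. (pi / \<sigma>) *\<^sub>R ((\<sigma> / pi) *\<^sub>R g (of_real x)))"
    unfolding g_real by (rule integrable_scaleR_right)
  then have intg: "integrable lborel (\<lambda>x. g (of_real x))"
    using \<sigma> by simp
  \<comment> \<open>A bound for \<open>g\<close> on the semicircle of radius \<open>R\<close>, where
    both |z - c| and |z - cnj c| are at least R - |c|. Times the arc length pi R it is a sum of
    terms of order R^(q-1) and R^(-1), and tends to 0.\<close>
  define B where "B R = (A * (1 + R) powr q + cmod (f c)) / (R - cmod c)\<^sup>2" for R
  have bound: "cmod (\<integral>x. indicator {-R..R} x *\<^sub>R g (of_real x) \<partial>lborel) \<le> B R * R * pi"
    if R: "R > cmod c" for R
  proof -
    have "R > 0" using R norm_ge_zero[of c] by linarith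
    have pathS: "path_image (linepath (of_real (-R)) (of_real R)) \<subseteq> S"
      using \<open>convex S\<close> \<open>e > 0\<close> \<sigma> unfolding path_image_linepath
      by (intro closed_segment_subset) (auto simp: S_def)
    have arcS: "Im z \<ge> 0 \<and> cmod z = R" if "z \<in> path_image (part_circlepath 0 R 0 pi)" for z
      using that \<open>R > 0\<close> by (auto simp: path_image_part_circlepath Im_exp norm_mult intro!: mult_nonneg_nonneg sin_ge_zero)
    have arcS': "path_image (part_circlepath 0 R 0 pi) \<subseteq> S"
      using arcS \<open>e > 0\<close> \<sigma> by (force simp: S_def)
    have ends: "pathstart (part_circlepath 0 R 0 pi) = of_real R" "pathfinish (part_circlepath 0 R 0 pi) = of_real (-R)"
      by simp_all
    have "(g has_contour_integral 0) (linepath (of_real (-R)) (of_real R) +++ part_circlepath 0 R 0 pi)"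
      using pathS arcS' ends
      by (intro Cauchy_theorem_convex_simple[OF hg \<open>convex S\<close>])
        (auto intro!: valid_path_join simp: path_image_join simp del: pathstart_part_circlepath pathfinish_part_circlepath of_real_minus)
    moreover have il: "g contour_integrable_on linepath (of_real (-R)) (of_real R)"
      using holomorphic_on_imp_continuous_on[OF hg] pathS
      by (intro contour_integrable_continuous_linepath) (auto elim: continuous_on_subset)
    moreover have ia: "g contour_integrable_on part_circlepath 0 R 0 pi"
      using holomorphic_on_imp_continuous_on[OF hg] arcS'
      by (intro contour_integrable_continuous_part_circlepath) (auto elim: continuous_on_subset)
    ultimately have "contour_integral (linepath (of_real (-R)) (of_real R)) g
        + contour_integral (part_circlepath 0 R 0 pi) g = 0"
      using ends
      by (subst contour_integral_join[symmetric]) (auto dest: contour_integral_unique simp del: of_real_minus pathstart_part_circlepath pathfinish_part_circlepath)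
    moreover have "cmod (contour_integral (part_circlepath 0 R 0 pi) g) \<le> B R * R * (pi - 0)"
    proof (rule has_contour_integral_bound_part_circlepath[OF has_contour_integral_integral[OF ia]])
      show "0 \<le> B R" using A by (simp add: B_def)
      fix z assume "z \<in> path_image (part_circlepath 0 R 0 pi)"
      with arcS have z: "Im z \<ge> 0" "cmod z = R" by auto
      have "z \<noteq> c" using z R by auto
      have "cmod (f z - f c) \<le> A * (1 + R) powr q + cmod (f c)"
        using f[OF z(1)] z(2) norm_triangle_ineq4[of "f z" "f c"] by simp
      moreover have "(R - cmod c) * (R - cmod c) \<le> cmod (z - c) * cmod (z - cnj c)"
        using R norm_triangle_ineq2[of z c] norm_triangle_ineq2[of z "cnj c"] z by (intro mult_mono) auto
      ultimately show "cmod (g z) \<le> B R"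
        using \<open>z \<noteq> c\<close> R A unfolding g_def B_def
        by (auto simp: norm_divide norm_mult divide_divide_eq_left power2_eq_square intro!: frac_le add_nonneg_nonneg)
    qed (use \<open>R > 0\<close> in auto)
    moreover have "contour_integral (linepath (of_real (-R)) (of_real R)) g
        = integral {-R..R} (\<lambda>x. g (of_real x))"
      using \<open>R > 0\<close> by (subst contour_integral_linepath_Reals_eq) auto
    moreover have "integral {-R..R} (\<lambda>x. g (of_real x)) = (\<integral>x. indicator {-R..R} x *\<^sub>R g (of_real x) \<partial>lborel)"
    proof -
      have "set_integrable lborel {-R..R} (\<lambda>x. g (of_real x))"
        unfolding set_integrable_def
        using integrable_mult_indicator[OF _ intg, of "{-R..R}"] by simp
      from set_borel_integral_eq_integral(2)[OF this] show ?thesis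
        by (simp add: set_lebesgue_integral_def)
    qed
    ultimately show ?thesis
      by (metis add_eq_0_iff norm_minus_cancel diff_zero)
  qed
  have "(\<lambda>n. \<integral>x. indicator {-real n..real n} x *\<^sub>R g (of_real x) \<partial>lborel) \<longlonglongrightarrow> (\<integral>x. g (of_real x) \<partial>lborel)"
  proof (rule integral_dominated_convergence)
    show "integrable lborel (\<lambda>x. norm (g (of_real x)))" using intg by simp
    show "AE x in lborel. (\<lambda>n. indicator {-real n..real n} x *\<^sub>R g (of_real x)) \<longlonglongrightarrow> g (of_real x)"
    proof (rule AE_I2)
      fix x :: real
      have "eventually (\<lambda>n. real n \<ge> \<bar>x\<bar>) sequentially"
        by (rule eventually_nat_real) simp
      then have "eventually (\<lambda>n. indicator {-real n..real n} x *\<^sub>R g (of_real x) = g (of_real x)) sequentially"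
        by eventually_elim (auto simp: indicator_def)
      then show "(\<lambda>n. indicator {-real n..real n} x *\<^sub>R g (of_real x)) \<longlonglongrightarrow> g (of_real x)"
        by (rule tendsto_eventually)
    qed
  qed (auto simp: indicator_def)
  moreover have "(\<lambda>n. \<integral>x. indicator {-real n..real n} x *\<^sub>R g (of_real x) \<partial>lborel) \<longlonglongrightarrow> 0"
  proof (rule Lim_null_comparison)
    have "eventually (\<lambda>n. real n > cmod c) sequentially" by real_asymp
    then show "\<forall>\<^sub>F n in sequentially. norm (\<integral>x. indicator {-real n..real n} x *\<^sub>R g (of_real x) \<partial>lborel) \<le> B (real n) * real n * pi"
      by eventually_elim (rule bound)
    show "(\<lambda>n. B (real n) * real n * pi) \<longlonglongrightarrow> 0"
    proof -
      have "(\<lambda>n. (1 + real n) powr q * real n / (real n - cmod c)\<^sup>2) \<longlonglongrightarrow> 0"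
        using \<open>q < 1\<close> by real_asymp
      moreover have "(\<lambda>n. cmod (f c) * real n / (real n - cmod c)\<^sup>2) \<longlonglongrightarrow> 0"
        by real_asymp
      ultimately have "(\<lambda>n. pi * (A * ((1 + real n) powr q * real n / (real n - cmod c)\<^sup>2)
          + cmod (f c) * real n / (real n - cmod c)\<^sup>2)) \<longlonglongrightarrow> pi * (A * 0 + 0)"
        by (intro tendsto_intros)
      then show ?thesis by (simp add: B_def field_simps add_divide_distrib)
    qed
  qed
  ultimately have "(\<integral>x. g (of_real x) \<partial>lborel) = 0"
    by (rule LIMSEQ_unique)
  then have "(\<integral>x. (\<sigma> / pi) *\<^sub>R g (of_real x) \<partial>lborel) = 0" by simp
  then have "integral\<^sup>L (cauchy_measure \<mu> \<sigma>) (\<lambda>x. f (of_real x) - f c) = 0"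
    unfolding g_real by (subst integral_cauchy_measure[OF \<sigma>]) auto
  then show ?thesis
    using intf by (simp add: c_def Q.prob_space[simplified])
qed

section \<open>The logarithm on the closed upper half-plane\<close>

lemma exp_i_half_pi: "exp (\<i> * of_real (pi / 2)) = \<i>"
  by (metis cis_conv_exp cis_pi_half)

text \<open>Multiplication by -i turns the closed upper half-plane into the closed right one, off
  the cut of \<open>Ln\<close>, with arguments in [-pi/2, pi/2]. Adding pi/2 back lands in [0, pi],
  inside the range of \<open>arg_br\<close>. Holomorphy, continuity and measurability of the branch
  are all inherited from \<open>Ln\<close> in this way.\<close>

lemma log_br_eq_Ln:
  assumes "z \<noteq> 0" "Im z \<ge> 0"
  shows "log_br z = Ln (- \<i> * z) + \<i> * of_real (pi / 2)"
proof -
  define w where "w = - \<i> * z"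
  have w: "w \<noteq> 0" "Re w \<ge> 0" "cmod w = cmod z" using assms by (auto simp: w_def norm_mult)
  have Lnw: "Ln w = of_real (ln (cmod z)) + \<i> * of_real (Im (Ln w))"
    using w by (simp add: complex_eq_iff)
  have z: "z = w * \<i>" by (simp add: w_def complex_eq_iff)
  have "is_Arg z (Im (Ln w) + pi / 2)"
  proof -
    have "z = exp (Ln w) * exp (\<i> * of_real (pi / 2))"
      unfolding exp_i_half_pi exp_Ln[OF w(1)] by (rule z)
    also have "exp (Ln w) = of_real (cmod z) * exp (\<i> * of_real (Im (Ln w)))"
      by (subst Lnw) (use assms in \<open>simp add: exp_add exp_of_real\<close>)
    finally show ?thesis
      by (simp add: is_Arg_def exp_add[symmetric] mult.assoc ring_distribs)
  qed
  moreover have "\<bar>Im (Ln w)\<bar> \<le> pi / 2" using w Re_Ln_pos_le by blast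
  then have "- pi / 2 \<le> Im (Ln w) + pi / 2" "Im (Ln w) + pi / 2 < 3 * pi / 2"
    using pi_gt_zero by linarith+
  ultimately have "arg_br z = Im (Ln w) + pi / 2"
    using assms by (intro arg_br_unique) auto
  then show ?thesis
    unfolding log_br_def w_def[symmetric] by (subst Lnw) (simp add: ring_distribs)
qed

lemma exp_log_br:
  assumes "z \<noteq> 0" "Im z \<ge> 0"
  shows "exp (log_br z) = z"
proof -
  have "- \<i> * z \<noteq> 0" using assms by simp
  then show ?thesis
    unfolding log_br_eq_Ln[OF assms] exp_add exp_i_half_pi by (subst exp_Ln) (auto simp: complex_eq_iff)
qed

lemma Re_log_br [simp]: "Re (log_br z) = ln (cmod z)"
  and Im_log_br [simp]: "Im (log_br z) = arg_br z"
  by (simp_all add: log_br_def)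

lemma
  assumes "z \<noteq> 0" "Im z \<ge> 0"
  shows arg_br_nonneg: "0 \<le> arg_br z" and arg_br_le_pi: "arg_br z \<le> pi"
    and arg_br_eq_arccos: "arg_br z = arccos (Re z / cmod z)"
proof -
  have w: "- \<i> * z \<noteq> 0" "Re (- \<i> * z) \<ge> 0" using assms by auto
  have "arg_br z = Im (Ln (- \<i> * z)) + pi / 2"
    using log_br_eq_Ln[OF assms] by (simp flip: Im_log_br)
  moreover have "\<bar>Im (Ln (- \<i> * z))\<bar> \<le> pi / 2" using w Re_Ln_pos_le by blast
  ultimately show *: "0 \<le> arg_br z" "arg_br z \<le> pi" by auto
  have "Re z = Re (exp (log_br z))" using exp_log_br[OF assms] by simp
  then have "Re z = cmod z * cos (arg_br z)"
    using assms by (simp add: Re_exp)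
  then have "Re z / cmod z = cos (arg_br z)" using assms by simp
  with * show "arg_br z = arccos (Re z / cmod z)" by (simp add: arccos_cos)
qed

lemma cmod_log_br_le:
  assumes "z \<noteq> 0" "Im z \<ge> 0"
  shows "cmod (log_br z) \<le> \<bar>ln (cmod z)\<bar> + pi"
  using cmod_le[of "log_br z"] arg_br_nonneg[OF assms] arg_br_le_pi[OF assms] by simp

lemma AE_of_real_plus_nonzero: "AE x in lborel. complex_of_real x + \<alpha> \<noteq> 0"
proof -
  have "AE x in lborel. x \<noteq> - Re \<alpha>" by (rule AE_lborel_singleton)
  then show ?thesis by eventually_elim (auto simp: complex_eq_iff)
qed

lemma log_br_measurable:
  assumes "Im \<alpha> \<ge> 0"
  shows "(\<lambda>x::real. log_br (of_real x + \<alpha>)) \<in> borel_measurable borel"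
proof -
  \<comment> \<open>At 0 every angle is an argument, so \<open>arg_br 0\<close> is an unspecified
    value; it is still one constant, which is enough for measurability.\<close>
  have "(\<lambda>x::real. log_br (of_real x + \<alpha>)) = (\<lambda>x. if of_real x + \<alpha> = 0 then log_br 0
      else Ln (- \<i> * (of_real x + \<alpha>)) + \<i> * of_real (pi / 2))"
    using assms by (auto simp: log_br_eq_Ln)
  also have "\<dots> \<in> borel_measurable borel" by measurable
  finally show ?thesis .
qed

section \<open>Exponential moments\<close>

text \<open>A single term of the exponential series of \<open>d * v\<close> is at most its sum. This
  trades a power for an arbitrarily small exponential rate.\<close>

lemma power_le_exp:
  fixes v d :: real
  assumes "v \<ge> 0" "d > 0"
  shows "v ^ k \<le> fact k / d ^ k * exp (d * v)"
proof -
  have "(d * v) ^ k / fact k \<le> exp (d * v)"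
  proof -
    have "(\<Sum>n\<in>{k}. (d * v) ^ n /\<^sub>R fact n) \<le> (\<Sum>n. (d * v) ^ n /\<^sub>R fact n)"
      using assms summable_exp_generic[of "d * v"] by (intro sum_le_suminf) auto
    then show ?thesis by (simp add: exp_def field_simps)
  qed
  then show ?thesis using assms by (simp add: power_mult_distrib field_simps)
qed

text \<open>For negative \<open>y\<close>, exp y * (1 - y) \<le> 1 \<le> 1 - y^3 = (1 + y + y^2) (1
  - y), and the positive factor 1 - y cancels.\<close>

lemma exp_le_quadratic:
  fixes y :: real
  assumes "\<bar>y\<bar> \<le> 1"
  shows "exp y \<le> 1 + y + y\<^sup>2"
proof (cases "y \<ge> 0")
  case True
  then show ?thesis using assms by (intro exp_bound) auto
next
  case False
  have "1 - y > 0" using False by simp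
  have "exp y * (1 - y) \<le> exp y * exp (- y)"
    using exp_ge_add_one_self[of "- y"] by (intro mult_left_mono) auto
  also have "\<dots> = 1" by (simp add: exp_minus)
  also have "1 \<le> 1 - y ^ 3" using False by (simp add: odd_power_less_zero)
  also have "\<dots> = (1 + y + y\<^sup>2) * (1 - y)"
    by (simp add: algebra_simps power2_eq_square power3_eq_cube)
  finally show ?thesis using \<open>1 - y > 0\<close> by simp
qed

text \<open>With y = n x_n, Bernoulli's inequality and the exponential give 1 + y \<le> (1 + x_n)^n
  \<le> exp y \<le> 1 + y + y^2 for large n. After subtracting 1 and multiplying by n, the main term
  n y tends to \<open>w\<close> and the error n y^2 is a product of a convergent and a null
  sequence.\<close>

lemma power_near_one_limit:
  fixes x :: "nat \<Rightarrow> real"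
  assumes x: "(\<lambda>n. real n ^ 2 * x n) \<longlonglongrightarrow> w"
  shows "(\<lambda>n. real n * ((1 + x n) ^ n - 1)) \<longlonglongrightarrow> w"
proof -
  have inv0: "(\<lambda>n. 1 / real n) \<longlonglongrightarrow> 0" by real_asymp
  have nx: "(\<lambda>n. real n * x n) \<longlonglongrightarrow> 0"
  proof -
    have "(\<lambda>n. (1 / real n) * (real n ^ 2 * x n)) \<longlonglongrightarrow> 0 * w"
      by (intro tendsto_mult inv0 x)
    moreover have "(1 / real n) * (real n ^ 2 * x n) = real n * x n" for n
      by (cases "n = 0") (auto simp: power2_eq_square)
    ultimately show ?thesis by simp
  qed
  have ex: "eventually (\<lambda>n. \<bar>real n * x n\<bar> < 1) sequentially"
    using tendstoD[OF nx, of 1] by simp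
  have up: "(\<lambda>n. real n ^ 2 * x n + \<bar>real n ^ 2 * x n\<bar> * \<bar>real n * x n\<bar>) \<longlonglongrightarrow> w + \<bar>w\<bar> * \<bar>0\<bar>"
    by (intro tendsto_intros x nx)
  have bounds: "eventually (\<lambda>n. real n ^ 2 * x n \<le> real n * ((1 + x n) ^ n - 1) \<and>
      real n * ((1 + x n) ^ n - 1) \<le> real n ^ 2 * x n + \<bar>real n ^ 2 * x n\<bar> * \<bar>real n * x n\<bar>) sequentially"
    using ex eventually_gt_at_top[of 0]
  proof eventually_elim
    case (elim n)
    define y where "y = real n * x n"
    have "\<bar>x n\<bar> \<le> \<bar>y\<bar>"
      using elim(2) by (simp add: y_def abs_mult mult_le_cancel_right1)
    then have xn: "x n \<ge> -1" and y: "\<bar>y\<bar> < 1" using elim(1) by (auto simp: y_def)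
    have lower: "1 + y \<le> (1 + x n) ^ n"
      unfolding y_def using Bernoulli_inequality[OF xn] by (simp add: mult.commute)
    have "(1 + x n) ^ n \<le> exp (x n) ^ n"
      using xn by (intro power_mono exp_ge_add_one_self) auto
    also have "\<dots> = exp y" by (simp add: y_def exp_of_nat_mult)
    also have "\<dots> \<le> 1 + y + y\<^sup>2"
      using y by (intro exp_le_quadratic) auto
    finally have "(1 + x n) ^ n - 1 \<le> y + y\<^sup>2" by simp
    then have "real n * ((1 + x n) ^ n - 1) \<le> real n * (y + y\<^sup>2)"
      by (intro mult_left_mono) auto
    also have "\<dots> = real n ^ 2 * x n + \<bar>real n ^ 2 * x n\<bar> * \<bar>real n * x n\<bar>"
      by (simp add: y_def power2_eq_square algebra_simps abs_mult)
    finally show ?case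
      using mult_left_mono[OF lower, of "real n"] by (simp add: y_def power2_eq_square algebra_simps)
  qed
  show ?thesis
  proof (rule tendsto_sandwich[OF _ _ x])
    show "(\<lambda>n. real n ^ 2 * x n + \<bar>real n ^ 2 * x n\<bar> * \<bar>real n * x n\<bar>) \<longlonglongrightarrow> w"
      using up by simp
  qed (use bounds in \<open>auto elim: eventually_mono\<close>)
qed

section \<open>Second-order expansions of exponential moments\<close>

context prob_space
begin

lemma integrable_power_of_exp:
  fixes Z :: "'a \<Rightarrow> complex"
  assumes [measurable]: "Z \<in> borel_measurable M"
    and int: "integrable M (\<lambda>x. exp (cmod (Z x) / 2))"
  shows "integrable M (\<lambda>x. Z x ^ k)"
proof -
  have "integrable M (\<lambda>x. fact k / (1 / 2) ^ k * exp (cmod (Z x) / 2))"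
    using int by (rule integrable_mult_right)
  then show ?thesis
  proof (rule Bochner_Integration.integrable_bound)
    show "AE x in M. norm (Z x ^ k) \<le> norm (fact k / (1 / 2) ^ k * exp (cmod (Z x) / 2))"
      using power_le_exp[of "cmod (Z _)" "1/2" k] by (auto simp: norm_power)
  qed simp
qed

lemma integrable_exp_scaled:
  fixes Z :: "'a \<Rightarrow> complex"
  assumes [measurable]: "Z \<in> borel_measurable M"
    and int: "integrable M (\<lambda>x. exp (cmod (Z x) / 2))" and "\<bar>t\<bar> \<le> 1 / 2"
  shows "integrable M (\<lambda>x. exp (of_real t * Z x))"
  using int
proof (rule Bochner_Integration.integrable_bound)
  have "t * Re (Z x) \<le> cmod (Z x) / 2" for x
  proof -
    have "t * Re (Z x) \<le> \<bar>t\<bar> * \<bar>Re (Z x)\<bar>" by (metis abs_ge_self abs_mult)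
    also have "\<dots> \<le> 1 / 2 * cmod (Z x)" using assms abs_Re_le_cmod by (intro mult_mono) auto
    finally show ?thesis by simp
  qed
  then show "AE x in M. norm (exp (of_real t * Z x)) \<le> norm (exp (cmod (Z x) / 2))"
    by auto
qed simp

text \<open>Taylor's formula leaves a remainder of order exp(t |Z|) (t |Z|)^3. With
  \<open>t \<le> 1/4\<close> the first factor uses half of the available exponential rate 1/2, and
  the other quarter absorbs |Z|^3.\<close>

lemma exp_moment_expansion:
  fixes Z :: "'a \<Rightarrow> complex"
  assumes [measurable]: "Z \<in> borel_measurable M"
    and int: "integrable M (\<lambda>x. exp (cmod (Z x) / 2))"
  obtains C where "C \<ge> 0" "\<And>t. 0 \<le> t \<Longrightarrow> t \<le> 1 / 4 \<Longrightarrow>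
    cmod (expectation (\<lambda>x. exp (of_real t * Z x)) -
      (1 + of_real t * expectation Z + of_real t ^ 2 / 2 * expectation (\<lambda>x. Z x ^ 2))) \<le> C * t ^ 3"
proof
  let ?D = "\<lambda>x. exp (cmod (Z x) / 2)"
  \<comment> \<open>192 = (1/2) * 3! * 4^3: the factor 1/2! of the Taylor remainder times the
    constant of \<open>power_le_exp\<close> for k = 3 and d = 1/4.\<close>
  show "192 * expectation ?D \<ge> 0" by simp
  fix t :: real assume t: "0 \<le> t" "t \<le> 1 / 4"
  have i1: "integrable M Z" and i2: "integrable M (\<lambda>x. Z x ^ 2)"
    using integrable_power_of_exp[OF assms, of 1] integrable_power_of_exp[OF assms, of 2] by auto
  have ie: "integrable M (\<lambda>x. exp (of_real t * Z x))"
    using t by (intro integrable_exp_scaled assms) auto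
  have bound: "cmod (exp (of_real t * Z x) - (1 + of_real t * Z x + of_real t ^ 2 / 2 * Z x ^ 2)) \<le> 192 * t ^ 3 * ?D x" for x
  proof -
    define v where "v = cmod (Z x)"
    have v: "v \<ge> 0" by (simp add: v_def)
    have "\<bar>Re (of_real t * Z x)\<bar> \<le> 1 / 4 * v"
      using mult_mono[OF t(2) abs_Re_le_cmod[of "Z x"]] t by (simp add: v_def abs_mult)
    have "cmod (exp (of_real t * Z x) - (1 + of_real t * Z x + of_real t ^ 2 / 2 * Z x ^ 2))
        = cmod (exp (of_real t * Z x) - (\<Sum>k\<le>2. (of_real t * Z x) ^ k / fact k))"
      by (simp add: numeral_2_eq_2 power_mult_distrib)
    also have "\<dots> \<le> exp \<bar>Re (of_real t * Z x)\<bar> * cmod (of_real t * Z x) ^ 3 / 2"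
      using Taylor_exp[of "of_real t * Z x" 2] by (simp add: numeral_3_eq_3)
    also have "\<dots> \<le> exp (1 / 4 * v) * cmod (of_real t * Z x) ^ 3 / 2"
      using \<open>\<bar>Re (of_real t * Z x)\<bar> \<le> 1 / 4 * v\<close> by (intro divide_right_mono mult_right_mono) auto
    also have "\<dots> = t ^ 3 / 2 * exp (1 / 4 * v) * v ^ 3"
      using t by (simp add: norm_mult power_mult_distrib v_def)
    also have "\<dots> \<le> t ^ 3 / 2 * exp (1 / 4 * v) * (fact 3 / (1 / 4) ^ 3 * exp (1 / 4 * v))"
      using t v by (intro mult_left_mono power_le_exp) auto
    also have "\<dots> = 192 * t ^ 3 * (exp (1 / 4 * v) * exp (1 / 4 * v))"
      by (simp add: fact_numeral power3_eq_cube)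
    also have "exp (1 / 4 * v) * exp (1 / 4 * v) = ?D x"
      by (simp add: v_def flip: exp_add)
    finally show ?thesis .
  qed
  have "expectation (\<lambda>x. exp (of_real t * Z x)) -
      (1 + of_real t * expectation Z + of_real t ^ 2 / 2 * expectation (\<lambda>x. Z x ^ 2))
    = expectation (\<lambda>x. exp (of_real t * Z x) - (1 + of_real t * Z x + of_real t ^ 2 / 2 * Z x ^ 2))"
    using i1 i2 ie by (simp add: prob_space)
  also have "cmod \<dots> \<le> expectation (\<lambda>x. 192 * t ^ 3 * ?D x)"
    using i1 i2 ie int bound by (intro order_trans[OF integral_norm_bound integral_mono]) auto
  also have "\<dots> = 192 * expectation ?D * t ^ 3" by simp
  finally show "cmod (expectation (\<lambda>x. exp (of_real t * Z x)) -
      (1 + of_real t * expectation Z + of_real t ^ 2 / 2 * expectation (\<lambda>x. Z x ^ 2))) \<le> 192 * expectation ?D * t ^ 3" .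
qed

text \<open>Both sides of \<open>eq\<close> have quadratic expansions with cubic error, so their
  difference t a1 + t^2 a2 is O(t^3). Dividing by t and letting t tend to 0 gives a1 = 0; dividing
  then by t^2 gives a2 = 0.\<close>

lemma expectation_eq_of_exp_moments:
  fixes Z :: "'a \<Rightarrow> complex"
  assumes [measurable]: "Z \<in> borel_measurable M"
    and int: "integrable M (\<lambda>x. exp (cmod (Z x) / 2))"
    and eq: "\<And>t. 0 < t \<Longrightarrow> t \<le> 1 / 4 \<Longrightarrow> expectation (\<lambda>x. exp (of_real t * Z x)) = exp (of_real t * b)"
  shows "expectation Z = b" "expectation (\<lambda>x. Z x ^ 2) = b ^ 2"
proof -
  obtain C1 where C1: "\<And>t. 0 \<le> t \<Longrightarrow> t \<le> 1 / 4 \<Longrightarrow>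
    cmod (expectation (\<lambda>x. exp (of_real t * Z x)) -
      (1 + of_real t * expectation Z + of_real t ^ 2 / 2 * expectation (\<lambda>x. Z x ^ 2))) \<le> C1 * t ^ 3"
    using exp_moment_expansion[OF assms(1,2)] by metis
  \<comment> \<open>The expansion of exp(t b) is the same lemma applied to the constant random
    variable \<open>b\<close>.\<close>
  obtain C2 where C2: "\<And>t. 0 \<le> t \<Longrightarrow> t \<le> 1 / 4 \<Longrightarrow>
    cmod (exp (of_real t * b) - (1 + of_real t * b + of_real t ^ 2 / 2 * b ^ 2)) \<le> C2 * t ^ 3"
    using exp_moment_expansion[of "\<lambda>_. b"] by (auto simp: prob_space)
  define a1 where "a1 = expectation Z - b"
  define a2 where "a2 = (expectation (\<lambda>x. Z x ^ 2) - b ^ 2) / 2"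
  have b3: "cmod (of_real t * a1 + of_real t ^ 2 * a2) \<le> (C1 + C2) * t ^ 3" if "0 < t" "t \<le> 1 / 4" for t
  proof -
    have "of_real t * a1 + of_real t ^ 2 * a2
      = (exp (of_real t * b) - (1 + of_real t * b + of_real t ^ 2 / 2 * b ^ 2)) -
        (expectation (\<lambda>x. exp (of_real t * Z x)) -
          (1 + of_real t * expectation Z + of_real t ^ 2 / 2 * expectation (\<lambda>x. Z x ^ 2)))"
      unfolding eq[OF that] a1_def a2_def by (simp add: field_simps)
    also have "cmod \<dots> \<le> C2 * t ^ 3 + C1 * t ^ 3"
      using C1[of t] C2[of t] that norm_triangle_ineq4 by (smt (verit))
    finally show ?thesis by (simp add: algebra_simps)
  qed
  \<comment> \<open>A null sequence that stays inside the admissible range (0, 1/4] from n = 0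
    on.\<close>
  define s where "s n = 1 / (real n + 4)" for n
  have s: "0 < s n" "s n \<le> 1 / 4" for n by (auto simp: s_def field_simps)
  have s0: "s \<longlonglongrightarrow> 0" unfolding s_def by real_asymp
  have "cmod (a1 + of_real (s n) * a2) \<le> (C1 + C2) * s n ^ 2" for n
  proof -
    have "s n * cmod (a1 + of_real (s n) * a2) \<le> s n * ((C1 + C2) * s n ^ 2)"
    proof -
      have "of_real (s n) * a1 + of_real (s n) ^ 2 * a2 = of_real (s n) * (a1 + of_real (s n) * a2)"
        by (simp add: algebra_simps power2_eq_square)
      then have "cmod (of_real (s n) * a1 + of_real (s n) ^ 2 * a2) = s n * cmod (a1 + of_real (s n) * a2)"
        using s(1)[of n] by (simp only: norm_mult norm_of_real abs_of_pos)
      then have "s n * cmod (a1 + of_real (s n) * a2) \<le> (C1 + C2) * s n ^ 3"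
        using b3[OF s[of n]] by (simp only:)
      also have "\<dots> = s n * ((C1 + C2) * s n ^ 2)"
        by (simp add: power2_eq_square power3_eq_cube)
      finally show ?thesis .
    qed
    then show ?thesis using s(1)[of n] by simp
  qed
  then have "(\<lambda>n. a1 + of_real (s n) * a2) \<longlonglongrightarrow> 0"
    using tendsto_mult[OF tendsto_const tendsto_power[OF s0, of 2], of "C1 + C2"]
    by (rule_tac Lim_null_comparison[of _ "\<lambda>n. (C1 + C2) * s n ^ 2"]) (simp_all add: zero_power2)
  moreover have "(\<lambda>n. a1 + of_real (s n) * a2) \<longlonglongrightarrow> a1 + of_real 0 * a2"
    by (intro tendsto_intros s0)
  ultimately have a1: "a1 = 0" using LIMSEQ_unique by fastforce
  have "cmod a2 \<le> (C1 + C2) * s n" for n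
  proof -
    have "s n ^ 2 * cmod a2 \<le> s n ^ 2 * ((C1 + C2) * s n)"
      using b3[OF s[of n]] s(1)[of n] a1
      by (simp add: power2_eq_square power3_eq_cube norm_mult algebra_simps)
    then show ?thesis using s(1)[of n] by simp
  qed
  then have "(\<lambda>n. a2) \<longlonglongrightarrow> 0"
    using tendsto_mult[OF tendsto_const s0, of "C1 + C2"]
    by (rule_tac Lim_null_comparison[of _ "\<lambda>n. (C1 + C2) * s n"]) simp_all
  then have a2: "a2 = 0" by (simp add: LIMSEQ_const_iff)
  from a1 a2 show "expectation Z = b" "expectation (\<lambda>x. Z x ^ 2) = b ^ 2"
    by (auto simp: a1_def a2_def)
qed

lemma exp_moment_expansion_real:
  fixes h :: "'a \<Rightarrow> real"
  assumes [measurable]: "h \<in> borel_measurable M"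
    and int: "integrable M (\<lambda>x. exp (\<bar>h x\<bar> / 2))"
  obtains C where "C \<ge> 0" "\<And>t. 0 \<le> t \<Longrightarrow> t \<le> 1 / 4 \<Longrightarrow>
    \<bar>expectation (\<lambda>x. exp (t * h x)) - (1 + t * expectation h + t\<^sup>2 / 2 * expectation (\<lambda>x. (h x)\<^sup>2))\<bar> \<le> C * t ^ 3"
proof -
  obtain C where C: "C \<ge> 0" "\<And>t. 0 \<le> t \<Longrightarrow> t \<le> 1 / 4 \<Longrightarrow>
    cmod (expectation (\<lambda>x. exp (of_real t * complex_of_real (h x))) -
      (1 + of_real t * expectation (\<lambda>x. complex_of_real (h x)) +
       of_real t ^ 2 / 2 * expectation (\<lambda>x. complex_of_real (h x) ^ 2))) \<le> C * t ^ 3"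
    using exp_moment_expansion[of "\<lambda>x. complex_of_real (h x)"] int by auto
  show ?thesis
  proof (rule that[OF C(1)])
    fix t :: real assume t: "0 \<le> t" "t \<le> 1 / 4"
    have "expectation (\<lambda>x. exp (of_real t * complex_of_real (h x))) -
      (1 + of_real t * expectation (\<lambda>x. complex_of_real (h x)) +
       of_real t ^ 2 / 2 * expectation (\<lambda>x. complex_of_real (h x) ^ 2))
      = complex_of_real (expectation (\<lambda>x. exp (t * h x)) - (1 + t * expectation h + t\<^sup>2 / 2 * expectation (\<lambda>x. (h x)\<^sup>2)))"
      unfolding of_real_mult[symmetric] of_real_power[symmetric] exp_of_real integral_complex_of_real by simp
    then show "\<bar>expectation (\<lambda>x. exp (t * h x)) - (1 + t * expectation h + t\<^sup>2 / 2 * expectation (\<lambda>x. (h x)\<^sup>2))\<bar> \<le> C * t ^ 3"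
      using C(2)[OF t] by (simp only: norm_of_real)
  qed
qed

lemma integrable_exp_scaled_real:
  fixes h :: "'a \<Rightarrow> real"
  assumes [measurable]: "h \<in> borel_measurable M"
    and int: "integrable M (\<lambda>x. exp (\<bar>h x\<bar> / 2))" and "\<bar>t\<bar> \<le> 1 / 2"
  shows "integrable M (\<lambda>x. exp (t * h x))"
proof -
  have "integrable M (\<lambda>x. Re (exp (of_real t * complex_of_real (h x))))"
    using assms by (intro integrable_Re integrable_exp_scaled) auto
  then show ?thesis by (simp add: Re_exp)
qed

text \<open>The Chernoff argument: for a centred \<open>h\<close> the moment E[exp(t h)] exceeds 1
  only by O(t^2), while exp(t e) exceeds 1 by at least t e, so a small t wins.\<close>

lemma exp_moment_less_one:
  fixes h :: "'a \<Rightarrow> real"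
  assumes [measurable]: "h \<in> borel_measurable M"
    and int: "integrable M (\<lambda>x. exp (\<bar>h x\<bar> / 2))" and "expectation h = 0" and "e > 0"
  obtains t where "0 < t" "t \<le> 1 / 4" "expectation (\<lambda>x. exp (t * (h x - e))) < 1"
proof -
  obtain C where C: "C \<ge> 0" "\<And>t. 0 \<le> t \<Longrightarrow> t \<le> 1 / 4 \<Longrightarrow>
    \<bar>expectation (\<lambda>x. exp (t * h x)) - (1 + t * expectation h + t\<^sup>2 / 2 * expectation (\<lambda>x. (h x)\<^sup>2))\<bar> \<le> C * t ^ 3"
    using exp_moment_expansion_real[OF assms(1,2)] by metis
  \<comment> \<open>\<open>K\<close> bounds the coefficient of t^2, the cubic error being at most C
    t^2; the summand 1 makes it positive. The choice of \<open>t\<close> below ensures K t \<le> e /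
    2, hence 1 + K t^2 \<le> exp(t e / 2).\<close>
  define K where "K = expectation (\<lambda>x. (h x)\<^sup>2) / 2 + C + 1"
  have K: "K > 0" using C(1) by (auto simp: K_def intro!: add_nonneg_pos)
  define t where "t = min (1 / 4) (e / (2 * K))"
  have t: "0 < t" "t \<le> 1 / 4" "t \<le> e / (2 * K)" using K \<open>e > 0\<close> by (auto simp: t_def)
  have "expectation (\<lambda>x. exp (t * h x)) \<le> 1 + t\<^sup>2 / 2 * expectation (\<lambda>x. (h x)\<^sup>2) + C * t ^ 3"
    using C(2)[of t] t assms(3) by auto
  also have "\<dots> \<le> 1 + t\<^sup>2 / 2 * expectation (\<lambda>x. (h x)\<^sup>2) + C * t\<^sup>2"
    using t C(1) by (intro add_left_mono mult_left_mono power_decreasing) auto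
  also have "1 + t\<^sup>2 / 2 * expectation (\<lambda>x. (h x)\<^sup>2) + C * t\<^sup>2 \<le> 1 + t * (K * t)"
    by (simp add: K_def power2_eq_square algebra_simps)
  also have "K * t \<le> e / 2"
    using t K by (simp add: field_simps)
  then have "1 + t * (K * t) \<le> 1 + t * (e / 2)"
    using t by (intro add_left_mono mult_left_mono) auto
  also have "\<dots> \<le> exp (t * (e / 2))" by (rule exp_ge_add_one_self)
  also have "\<dots> < exp (t * e)" using t \<open>e > 0\<close> by simp
  finally have "expectation (\<lambda>x. exp (t * h x)) < exp (t * e)" .
  moreover have "expectation (\<lambda>x. exp (t * (h x - e))) = expectation (\<lambda>x. exp (t * h x)) / exp (t * e)"
    by (simp add: right_diff_distrib exp_diff)
  ultimately have "expectation (\<lambda>x. exp (t * (h x - e))) < 1" by simp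
  with t show ?thesis using that by blast
qed

section \<open>Almost sure convergence of averages, and convergence of means\<close>

text \<open>The exponential moments of the partial sums are summable, so almost surely the exponentials
  themselves are summable along the sequence and hence eventually at most 1.\<close>

lemma AE_eventually_sum_le:
  fixes Z :: "nat \<Rightarrow> 'a \<Rightarrow> real"
  assumes indep: "indep_vars (\<lambda>_. borel) Z {1..}" and "t > 0" "\<rho> < 1"
    and int: "\<And>j. j \<ge> 1 \<Longrightarrow> integrable M (\<lambda>\<omega>. exp (t * Z j \<omega>))"
    and le: "\<And>j. j \<ge> 1 \<Longrightarrow> expectation (\<lambda>\<omega>. exp (t * Z j \<omega>)) \<le> \<rho>"
  shows "AE \<omega> in M. eventually (\<lambda>n. (\<Sum>j=1..n. Z j \<omega>) \<le> 0) sequentially"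
proof -
  have [measurable]: "Z j \<in> borel_measurable M" if "j \<ge> 1" for j
    using indep that by (auto simp: indep_vars_def)
  have "\<rho> \<ge> 0" using order_trans[OF Bochner_Integration.integral_nonneg le[of 1]] by simp
  define E where "E n \<omega> = exp (t * (\<Sum>j=1..n. Z j \<omega>))" for n \<omega>
  have E_eq: "E n \<omega> = (\<Prod>j=1..n. exp (t * Z j \<omega>))" for n \<omega>
    by (simp add: E_def sum_distrib_left exp_sum)
  have [measurable]: "E n \<in> borel_measurable M" for n
    unfolding E_def[abs_def] by measurable
  have indep': "indep_vars (\<lambda>_. borel) (\<lambda>j \<omega>. exp (t * Z j \<omega>)) {1..n}" for n
    by (rule indep_vars_compose2[OF indep_vars_subset[OF indep]]) auto
  have nn: "(\<integral>\<^sup>+\<omega>. ennreal (E n \<omega>) \<partial>M) \<le> ennreal (\<rho> ^ n)" for n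
  proof -
    have "integrable M (E n)"
      unfolding E_eq[abs_def] by (intro indep_vars_integrable indep') (auto intro: int)
    then have "(\<integral>\<^sup>+\<omega>. ennreal (E n \<omega>) \<partial>M) = ennreal (expectation (E n))"
      by (rule nn_integral_eq_integral) (auto simp: E_def)
    also have "expectation (E n) = (\<Prod>j=1..n. expectation (\<lambda>\<omega>. exp (t * Z j \<omega>)))"
      unfolding E_eq[abs_def] by (intro indep_vars_lebesgue_integral indep') (auto intro: int)
    also have "\<dots> \<le> (\<Prod>j=1..n. \<rho>)"
      by (intro prod_mono) (auto intro: le)
    finally show ?thesis by (simp add: ennreal_leI)
  qed
  have "(\<integral>\<^sup>+\<omega>. (\<Sum>n. ennreal (E n \<omega>)) \<partial>M) = (\<Sum>n. \<integral>\<^sup>+\<omega>. ennreal (E n \<omega>) \<partial>M)"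
    by (rule nn_integral_suminf) simp
  also have "\<dots> \<le> (\<Sum>n. ennreal (\<rho> ^ n))"
    by (intro suminf_le nn) auto
  also have "\<dots> < \<infinity>"
    using \<open>\<rho> \<ge> 0\<close> \<open>\<rho> < 1\<close> by (simp add: less_top[symmetric] ennreal_suminf_neq_top summable_geometric)
  finally have "AE \<omega> in M. (\<Sum>n. ennreal (E n \<omega>)) \<noteq> \<infinity>"
    by (intro nn_integral_PInf_AE) auto
  then show ?thesis
  proof eventually_elim
    case (elim \<omega>)
    then have "summable (\<lambda>n. E n \<omega>)"
      by (intro summable_suminf_not_top) (auto simp: E_def)
    then have "(\<lambda>n. E n \<omega>) \<longlonglongrightarrow> 0" by (rule summable_LIMSEQ_zero)
    then have "eventually (\<lambda>n. E n \<omega> < 1) sequentially" by (rule order_tendstoD) simp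
    then show ?case
      by eventually_elim (use \<open>t > 0\<close> in \<open>auto simp: E_def mult_less_0_iff\<close>)
  qed
qed

text \<open>The one-sided bound \<open>upper\<close> is applied to \<open>h\<close> and to
  \<open>- h\<close>. Taking the error levels 1/(k + 1) makes the exceptional events countable in
  number, so almost surely all the bounds hold at once.\<close>

lemma strong_law_exp_moment:
  fixes X :: "nat \<Rightarrow> 'a \<Rightarrow> 'b" and h :: "'b \<Rightarrow> real"
  assumes indep: "indep_vars (\<lambda>_. N) X {1..}"
    and distr: "\<And>j. j \<ge> 1 \<Longrightarrow> distr M N (X j) = D"
    and [measurable]: "h \<in> borel_measurable N"
    and int: "integrable D (\<lambda>x. exp (\<bar>h x\<bar> / 2))" and mean: "integral\<^sup>L D h = 0"
  shows "AE \<omega> in M. (\<lambda>n. (\<Sum>j=1..n. h (X j \<omega>)) / real n) \<longlonglongrightarrow> 0"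
proof -
  have [measurable]: "X j \<in> measurable M N" if "j \<ge> 1" for j
    using indep that by (auto simp: indep_vars_def)
  have D: "D = distr M N (X 1)" using distr[of 1] by simp
  interpret D: prob_space D unfolding D by (rule prob_space_distr) simp
  have sets_D [measurable_cong]: "sets D = sets N" by (simp add: D)
  have upper: "AE \<omega> in M. eventually (\<lambda>n. (\<Sum>j=1..n. g (X j \<omega>)) \<le> e * real n) sequentially"
    if [measurable]: "g \<in> borel_measurable N" and g: "integrable D (\<lambda>x. exp (\<bar>g x\<bar> / 2))" "integral\<^sup>L D g = 0"
      and "e > 0" for g :: "'b \<Rightarrow> real" and e
  proof -
    have gD: "g \<in> borel_measurable D" by measurable
    obtain t where t: "0 < t" "t \<le> 1 / 4" "D.expectation (\<lambda>x. exp (t * (g x - e))) < 1"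
      using D.exp_moment_less_one[OF gD g \<open>e > 0\<close>] by metis
    have int_t: "integrable D (\<lambda>x. exp (t * (g x - e)))"
    proof -
      have "integrable D (\<lambda>x. exp (t * g x) / exp (t * e))"
        using D.integrable_exp_scaled_real[OF gD g(1), of t] t by simp
      then show ?thesis by (simp add: right_diff_distrib exp_diff)
    qed
    \<comment> \<open>Subtracting \<open>e\<close> gives the summands negative mean, and for the
      tilt \<open>t\<close> their common exponential moment is below 1, which is the ratio of the
      geometric series.\<close>
    have "AE \<omega> in M. eventually (\<lambda>n. (\<Sum>j=1..n. g (X j \<omega>) - e) \<le> 0) sequentially"
    proof (rule AE_eventually_sum_le[OF _ t(1) t(3)])
      show "indep_vars (\<lambda>_. borel) (\<lambda>j \<omega>. g (X j \<omega>) - e) {1..}"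
        by (rule indep_vars_compose2[OF indep]) simp
    next
      fix j :: nat assume j: "j \<ge> 1"
      show "integrable M (\<lambda>\<omega>. exp (t * (g (X j \<omega>) - e)))"
        using int_t j unfolding distr[OF j, symmetric] by (subst (asm) integrable_distr_eq) auto
      show "expectation (\<lambda>\<omega>. exp (t * (g (X j \<omega>) - e))) \<le> D.expectation (\<lambda>x. exp (t * (g x - e)))"
        using j unfolding distr[OF j, symmetric] by (subst integral_distr) auto
    qed
    then show ?thesis by (simp add: sum_subtractf mult.commute)
  qed
  have "AE \<omega> in M. \<forall>k. eventually (\<lambda>n. (\<Sum>j=1..n. h (X j \<omega>)) \<le> 1 / real (Suc k) * real n) sequentially"
    unfolding AE_all_countable using int mean by (intro allI upper) auto
  moreover have "AE \<omega> in M. \<forall>k. eventually (\<lambda>n. (\<Sum>j=1..n. - h (X j \<omega>)) \<le> 1 / real (Suc k) * real n) sequentially"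
    unfolding AE_all_countable using int mean by (intro allI upper) auto
  ultimately show ?thesis
  proof eventually_elim
    case (elim \<omega>)
    show ?case
    proof (rule LIMSEQ_I)
      fix r :: real assume "r > 0"
      then obtain k where k: "1 / real (Suc k) < r" using nat_approx_posE by blast
      have "eventually (\<lambda>n. norm ((\<Sum>j=1..n. h (X j \<omega>)) / real n - 0) < r) sequentially"
        using elim(1)[rule_format, of k] elim(2)[rule_format, of k] eventually_gt_at_top[of 0]
      proof eventually_elim
        case (elim n)
        then have "\<bar>\<Sum>j=1..n. h (X j \<omega>)\<bar> \<le> 1 / real (Suc k) * real n"
          by (simp add: sum_negf abs_le_iff)
        also have "\<dots> < r * real n" using k elim by (intro mult_strict_right_mono) auto
        finally show ?case using elim by (simp add: field_simps)
      qed
      then show "\<exists>n0. \<forall>n\<ge>n0. norm ((\<Sum>j=1..n. h (X j \<omega>)) / real n - 0) < r"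
        by (simp add: eventually_sequentially)
    qed
  qed
qed

text \<open>Bounded second moments give uniform integrability, here in the form Y \<le> min(Y, K) +
  Y^2 / K: dominated convergence handles the truncation, and the rest has mean at most B /
  K.\<close>

lemma expectation_tendsto_0_of_bounded_square:
  fixes Y :: "nat \<Rightarrow> 'a \<Rightarrow> real"
  assumes [measurable]: "\<And>n. Y n \<in> borel_measurable M" and nonneg: "\<And>n x. 0 \<le> Y n x"
    and lim: "AE x in M. (\<lambda>n. Y n x) \<longlonglongrightarrow> 0"
    and sq: "\<forall>\<^sub>F n in sequentially. integrable M (\<lambda>x. (Y n x)\<^sup>2) \<and> expectation (\<lambda>x. (Y n x)\<^sup>2) \<le> B"
  shows "(\<lambda>n. expectation (Y n)) \<longlonglongrightarrow> 0"
proof (rule tendstoI)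
  fix e :: real assume "e > 0"
  \<comment> \<open>Chosen so that (|B| + 1) / K = e / 2; the 1 keeps \<open>K\<close> positive when
    \<open>B\<close> is 0.\<close>
  define K where "K = 2 * (\<bar>B\<bar> + 1) / e"
  have "K > 0" using \<open>e > 0\<close> by (simp add: K_def)
  have norm_min: "\<bar>min (Y n x) K\<bar> \<le> K" for n x
    using nonneg[of n x] \<open>K > 0\<close> by auto
  have "(\<lambda>n. expectation (\<lambda>x. min (Y n x) K)) \<longlonglongrightarrow> expectation (\<lambda>x. 0)"
  proof (rule integral_dominated_convergence)
    show "AE x in M. (\<lambda>n. min (Y n x) K) \<longlonglongrightarrow> 0"
      using lim
    proof eventually_elim
      case (elim x)
      then have "(\<lambda>n. min (Y n x) K) \<longlonglongrightarrow> min 0 K" by (intro tendsto_min tendsto_const)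
      then show ?case using \<open>K > 0\<close> by simp
    qed
    show "AE x in M. norm (min (Y n x) K) \<le> K" for n
      using norm_min by simp
  qed auto
  then have "eventually (\<lambda>n. expectation (\<lambda>x. min (Y n x) K) < e / 2) sequentially"
    using \<open>e > 0\<close> by (intro order_tendstoD) auto
  with sq show "eventually (\<lambda>n. dist (expectation (Y n)) 0 < e) sequentially"
  proof eventually_elim
    case (elim n)
    have "Y n x \<le> min (Y n x) K + (Y n x)\<^sup>2 / K" for x
    proof (cases "Y n x \<le> K")
      case False
      then have "Y n x * K \<le> Y n x * Y n x"
        using \<open>K > 0\<close> by (intro mult_left_mono) auto
      then have "Y n x \<le> (Y n x)\<^sup>2 / K"
        using \<open>K > 0\<close> by (simp add: field_simps power2_eq_square)
      then show ?thesis using False \<open>K > 0\<close> by simp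
    qed (use \<open>K > 0\<close> in simp)
    moreover have imin: "integrable M (\<lambda>x. min (Y n x) K)"
      using norm_min by (intro integrable_const_bound[where B=K]) auto
    moreover have isq: "integrable M (\<lambda>x. (Y n x)\<^sup>2 / K)" using elim by simp
    ultimately have "expectation (Y n) \<le> expectation (\<lambda>x. min (Y n x) K + (Y n x)\<^sup>2 / K)"
      using nonneg \<open>K > 0\<close> by (intro integral_mono' Bochner_Integration.integrable_add imin isq) auto
    also have "\<dots> = expectation (\<lambda>x. min (Y n x) K) + expectation (\<lambda>x. (Y n x)\<^sup>2) / K"
      using imin isq by simp
    also have "\<dots> < e / 2 + e / 2"
    proof (rule add_less_le_mono)
      have "expectation (\<lambda>x. (Y n x)\<^sup>2) / K \<le> (\<bar>B\<bar> + 1) / K"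
        using elim \<open>K > 0\<close> by (intro divide_right_mono) auto
      also have "\<dots> = e / 2"
      proof -
        have cancel: "c / (2 * c / e) = e / 2" if "c > 0" for c using that \<open>e > 0\<close> by simp
        show ?thesis unfolding K_def by (rule cancel) simp
      qed
      finally show "expectation (\<lambda>x. (Y n x)\<^sup>2) / K \<le> e / 2" .
    qed (use elim in auto)
    finally have "expectation (Y n) < e" by simp
    moreover have "expectation (Y n) \<ge> 0" using nonneg by simp
    ultimately show ?case by simp
  qed
qed

end

section \<open>Powers and logarithms of a shifted Cauchy variable\<close>

lemma integrable_abs_powr_near_0:
  assumes "- 1 < s"
  shows "integrable lborel (\<lambda>x::real. indicator {0..1} \<bar>x\<bar> *\<^sub>R \<bar>x\<bar> powr s)"
proof -
  define f :: "real \<Rightarrow> real" where "f = (\<lambda>x. indicator {0..1} x *\<^sub>R x powr s)"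
  have [measurable]: "f \<in> borel_measurable borel" unfolding f_def by measurable
  have "(\<lambda>x. x powr s) absolutely_integrable_on {0..1}"
    using integrable_on_powr_from_0[OF assms, of 1]
    by (intro nonnegative_absolutely_integrable_1) auto
  then have "integrable lborel f"
    unfolding set_integrable_def f_def [symmetric] by (subst (asm) integrable_completion) auto
  then have "integrable lborel (\<lambda>x. f (0 + 1 * x) + f (0 + (-1) * x))"
    by (intro Bochner_Integration.integrable_add lborel_integrable_real_affine) auto
  then show ?thesis
    by (rule Bochner_Integration.integrable_bound) (auto simp: f_def indicator_def)
qed

locale shifted_cauchy =
  fixes \<mu> \<sigma> :: real and \<alpha> :: complex
  assumes \<sigma>_pos: "\<sigma> > 0" and Im_\<alpha>: "Im \<alpha> \<ge> 0"
begin

definition "Q = cauchy_measure \<mu> \<sigma>"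
definition "L x = log_br (of_real x + \<alpha>)" for x :: real
definition "\<beta> = Complex \<mu> \<sigma> + \<alpha>"

sublocale Q: prob_space Q
  unfolding Q_def by (rule prob_space_cauchy_measure[OF \<sigma>_pos])

lemma sets_Q [simp, measurable_cong]: "sets Q = sets borel"
  by (simp add: Q_def)

lemma space_Q [simp]: "space Q = UNIV"
  by (simp add: Q_def)

lemma L_measurable [measurable]: "L \<in> borel_measurable borel"
  unfolding L_def[abs_def] by (rule log_br_measurable[OF Im_\<alpha>])

lemma \<beta>: "Im \<beta> > 0" "\<beta> \<noteq> 0"
  using \<sigma>_pos Im_\<alpha> by (auto simp: \<beta>_def complex_eq_iff)

lemma AE_Q_nonzero: "AE x in Q. of_real x + \<alpha> \<noteq> 0"
  unfolding Q_def by (intro AE_cauchy_measure AE_of_real_plus_nonzero)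

text \<open>The density is bounded by 1 / (pi \<sigma>), and the power -1/2 is integrable at 0. It
  serves as majorant near x = - Re \<alpha>, where for real \<alpha> the logarithm is
  singular.\<close>

lemma integrable_abs_powr_near_pole: "integrable Q (\<lambda>x. indicator {0..1} \<bar>x + Re \<alpha>\<bar> *\<^sub>R \<bar>x + Re \<alpha>\<bar> powr (-1/2))"
proof -
  define h :: "real \<Rightarrow> real" where "h = (\<lambda>x. indicator {0..1} \<bar>x\<bar> *\<^sub>R \<bar>x\<bar> powr (-1/2))"
  have [measurable]: "h \<in> borel_measurable borel" unfolding h_def by measurable
  have "integrable lborel h" unfolding h_def by (rule integrable_abs_powr_near_0) simp
  then have "integrable lborel (\<lambda>x. (\<sigma> / pi * (1 / \<sigma>\<^sup>2)) * h (Re \<alpha> + 1 * x))"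
    by (intro integrable_mult_right lborel_integrable_real_affine) auto
  then have "integrable lborel (\<lambda>x. cauchy_density \<mu> \<sigma> x *\<^sub>R h (x + Re \<alpha>))"
  proof (rule Bochner_Integration.integrable_bound)
    show "AE x in lborel. norm (cauchy_density \<mu> \<sigma> x *\<^sub>R h (x + Re \<alpha>))
        \<le> norm (\<sigma> / pi * (1 / \<sigma>\<^sup>2) * h (Re \<alpha> + 1 * x))"
    proof (rule AE_I2)
      fix x
      have "cauchy_density \<mu> \<sigma> x \<le> \<sigma> / pi * (1 / \<sigma>\<^sup>2)"
        unfolding cauchy_density_def using \<sigma>_pos by (intro mult_left_mono frac_le) auto
      moreover have "h (x + Re \<alpha>) \<ge> 0" by (simp add: h_def)
      ultimately have "cauchy_density \<mu> \<sigma> x * h (x + Re \<alpha>) \<le> \<sigma> / pi * (1 / \<sigma>\<^sup>2) * h (x + Re \<alpha>)"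
        by (rule mult_right_mono)
      then show "norm (cauchy_density \<mu> \<sigma> x *\<^sub>R h (x + Re \<alpha>))
        \<le> norm (\<sigma> / pi * (1 / \<sigma>\<^sup>2) * h (Re \<alpha> + 1 * x))"
        using cauchy_density_nonneg[OF \<sigma>_pos, of \<mu> x] \<open>h (x + Re \<alpha>) \<ge> 0\<close> \<sigma>_pos
        by (simp add: add.commute)
    qed
  qed simp
  then have "integrable Q (\<lambda>x. h (x + Re \<alpha>))"
    unfolding Q_def using \<sigma>_pos by (subst integrable_cauchy_measure) auto
  then show ?thesis by (simp add: h_def)
qed

text \<open>The argument contributes at most a factor exp(pi/2). With r = |x + \<alpha>| the rest is
  max(r, 1/r) to the power 1/2: large r is covered by the growth threshold, small r by r \<ge> |x +
  Re \<alpha>| and the integrable singularity.\<close>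

lemma integrable_exp_L: "integrable Q (\<lambda>x. exp (cmod (L x) / 2))"
proof -
  define A where "A = (1 + cmod \<alpha>) powr (1/2)"
  define h :: "real \<Rightarrow> real" where "h = (\<lambda>x. indicator {0..1} \<bar>x + Re \<alpha>\<bar> *\<^sub>R \<bar>x + Re \<alpha>\<bar> powr (-1/2))"
  have "integrable Q (\<lambda>x. A * (1 + \<bar>x\<bar>) powr (1/2))"
    unfolding Q_def using \<sigma>_pos
    by (rule integrable_cauchy_measure_powr_bound[where q = "1/2" and A = A]) (auto simp: A_def)
  then have "integrable Q (\<lambda>x. exp (pi / 2) * (A * (1 + \<bar>x\<bar>) powr (1/2) + (1 + h x)))"
    using integrable_abs_powr_near_pole unfolding h_def[symmetric]
    by (intro integrable_mult_right[of "exp (pi / 2)"] Bochner_Integration.integrable_add Q.integrable_const)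
  then show ?thesis
  proof (rule Bochner_Integration.integrable_bound)
    have "AE x in Q. x + Re \<alpha> \<noteq> 0"
    proof -
      have "AE x in lborel. x \<noteq> - Re \<alpha>" by (rule AE_lborel_singleton)
      then have "AE x in lborel. x + Re \<alpha> \<noteq> 0" by eventually_elim auto
      then show ?thesis unfolding Q_def by (rule AE_cauchy_measure)
    qed
    then show "AE x in Q. norm (exp (cmod (L x) / 2))
        \<le> norm (exp (pi / 2) * (A * (1 + \<bar>x\<bar>) powr (1/2) + (1 + h x)))"
    proof eventually_elim
      fix x assume x: "x + Re \<alpha> \<noteq> 0"
      define r where "r = cmod (of_real x + \<alpha>)"
      have nz: "of_real x + \<alpha> \<noteq> 0" using x by (auto simp: complex_eq_iff)
      then have r: "r > 0" by (simp add: r_def)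
      have "cmod (L x) / 2 \<le> pi / 2 + \<bar>ln r\<bar> / 2"
        using cmod_log_br_le[OF nz] Im_\<alpha> by (simp add: L_def r_def)
      then have "exp (cmod (L x) / 2) \<le> exp (pi / 2) * exp (\<bar>ln r\<bar> / 2)"
        by (simp flip: exp_add)
      also have "exp (\<bar>ln r\<bar> / 2) \<le> r powr (1/2) + r powr (-1/2)"
        using r by (cases "ln r \<ge> 0") (auto simp: powr_def add_increasing add_increasing2)
      also have "r powr (1/2) \<le> A * (1 + \<bar>x\<bar>) powr (1/2)"
      proof -
        have "r \<le> \<bar>x\<bar> + cmod \<alpha>"
          unfolding r_def using norm_triangle_ineq[of "of_real x" \<alpha>] by simp
        also have "\<dots> \<le> (1 + cmod \<alpha>) * (1 + \<bar>x\<bar>)" by (simp add: algebra_simps)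
        finally show ?thesis
          unfolding A_def using r by (subst powr_mult[symmetric]) (auto intro!: powr_mono2)
      qed
      also have "r powr (-1/2) \<le> 1 + h x"
      proof -
        have rx: "\<bar>x + Re \<alpha>\<bar> \<le> r" unfolding r_def using abs_Re_le_cmod[of "of_real x + \<alpha>"] by simp
        then have "r powr (-1/2) \<le> \<bar>x + Re \<alpha>\<bar> powr (-1/2)"
          using x by (intro powr_mono2') auto
        moreover have "\<bar>x + Re \<alpha>\<bar> powr (-1/2) \<le> 1" if "\<bar>x + Re \<alpha>\<bar> > 1"
          using that powr_mono2'[of "-1/2" 1 "\<bar>x + Re \<alpha>\<bar>"] by simp
        ultimately show ?thesis
          by (cases "\<bar>x + Re \<alpha>\<bar> > 1") (auto simp: h_def)
      qed
      finally show "norm (exp (cmod (L x) / 2))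
          \<le> norm (exp (pi / 2) * (A * (1 + \<bar>x\<bar>) powr (1/2) + (1 + h x)))"
        by simp
    qed
  qed simp
qed

text \<open>The mean value identity is exact for each shift \<open>a k\<close>. Since
  \<open>p\<close> is positive, the modulus of the p-th power stays bounded at the branch point, so
  one majorant serves all \<open>k\<close> and dominated convergence yields the identity at \<alpha>
  itself.\<close>

lemma expectation_exp_L:
  assumes p: "0 < p" "p \<le> 1 / 2"
  shows "Q.expectation (\<lambda>x. exp (of_real p * L x)) = exp (of_real p * log_br \<beta>)"
proof -
  \<comment> \<open>The p-th power of the chosen branch, written through \<open>Ln\<close> to have
    holomorphy and limits available.\<close>
  define F where "F = (\<lambda>z. exp (of_real p * (Ln (- \<i> * z) + \<i> * of_real (pi / 2))))"
  define d where "d k = 1 / (real k + 1)" for k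
  have d: "0 < d k" "d k \<le> 1" for k by (auto simp: d_def)
  have d0: "d \<longlonglongrightarrow> 0" unfolding d_def by real_asymp
  \<comment> \<open>For real \<open>\<alpha>\<close> the branch point lies on the line of integration; approach it from above.\<close>
  define a where "a k = \<alpha> + \<i> * of_real (d k)" for k
  have a: "Im (a k) \<ge> d k" for k using Im_\<alpha> by (simp add: a_def)
  have norm_a: "cmod (a k) \<le> cmod \<alpha> + 1" for k
    using norm_triangle_ineq[of \<alpha> "\<i> * of_real (d k)"] d[of k] by (simp add: a_def norm_mult)
  have F_eq: "F z = exp (of_real p * log_br z)" if "z \<noteq> 0" "Im z \<ge> 0" for z
    using that by (simp add: F_def log_br_eq_Ln)
  have norm_F: "cmod (F z) = cmod z powr p" if "z \<noteq> 0" "Im z \<ge> 0" for z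
    using that by (simp add: F_eq powr_def)
  have lim_F: "(\<lambda>k. F (z + \<i> * of_real (d k))) \<longlonglongrightarrow> F z" if "z \<noteq> 0" "Im z \<ge> 0" for z
  proof -
    have "- \<i> * z \<notin> \<real>\<^sub>\<le>\<^sub>0" using that by (auto simp: complex_nonpos_Reals_iff complex_eq_iff)
    moreover have "(\<lambda>k. z + \<i> * of_real (d k)) \<longlonglongrightarrow> z + \<i> * of_real 0"
      by (intro tendsto_intros d0)
    ultimately show ?thesis unfolding F_def by (intro tendsto_intros tendsto_Ln) simp_all
  qed
  have step: "Q.expectation (\<lambda>x. F (of_real x + a k)) = F (\<beta> + \<i> * of_real (d k))" for k
  proof -
    have "F (Complex \<mu> \<sigma> + a k) = Q.expectation (\<lambda>x. F (of_real x + a k))"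
      unfolding Q_def
    \<comment> \<open>The margin \<open>d k\<close> keeps \<open>z + a k\<close> in the open upper
      half-plane. The constant comes from |z| + |\<alpha>| + 1 \<le> (2 + |\<alpha>|) (1 +
      |z|).\<close>
    proof (rule integral_cauchy_measure_holomorphic[symmetric, OF \<sigma>_pos, where e = "d k" and q = p and A = "(2 + cmod \<alpha>) powr p"])
      show "(\<lambda>z. F (z + a k)) holomorphic_on {z. - d k < Im z}"
        unfolding F_def using a[of k]
        by (intro holomorphic_intros) (auto simp: complex_nonpos_Reals_iff)
    next
      fix z assume z: "0 \<le> Im z"
      have nz: "Im (z + a k) > 0" using z a[of k] d[of k] by simp
      have "cmod (z + a k) \<le> cmod z + (cmod \<alpha> + 1)"
        using norm_triangle_ineq[of z "a k"] norm_a[of k] by simp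
      also have "\<dots> \<le> (2 + cmod \<alpha>) * (1 + cmod z)" by (simp add: algebra_simps)
      finally have "cmod (z + a k) powr p \<le> ((2 + cmod \<alpha>) * (1 + cmod z)) powr p"
        using p by (intro powr_mono2) auto
      moreover have "cmod (F (z + a k)) = cmod (z + a k) powr p"
        using nz by (intro norm_F) (auto simp: complex_eq_iff)
      ultimately show "cmod (F (z + a k)) \<le> (2 + cmod \<alpha>) powr p * (1 + cmod z) powr p"
        by (simp add: powr_mult)
    qed (use p d in auto)
    then show ?thesis by (simp add: \<beta>_def a_def add.assoc)
  qed
  have "(\<lambda>k. Q.expectation (\<lambda>x. F (of_real x + a k))) \<longlonglongrightarrow> Q.expectation (\<lambda>x. exp (of_real p * L x))"
  proof (rule integral_dominated_convergence)
    show "AE x in Q. (\<lambda>k. F (of_real x + a k)) \<longlonglongrightarrow> exp (of_real p * L x)"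
      using AE_Q_nonzero
    proof eventually_elim
      fix x :: real assume x: "of_real x + \<alpha> \<noteq> 0"
      then show "(\<lambda>k. F (of_real x + a k)) \<longlonglongrightarrow> exp (of_real p * L x)"
        using lim_F[OF x] Im_\<alpha> by (simp add: F_eq L_def a_def add.assoc)
    qed
    show "integrable Q (\<lambda>x. (2 + cmod \<alpha>) powr p * (1 + \<bar>x\<bar>) powr p)"
      unfolding Q_def using \<sigma>_pos
      by (rule integrable_cauchy_measure_powr_bound[where q = p and A = "(2 + cmod \<alpha>) powr p"]) (use p in auto)
    show "AE x in Q. norm (F (of_real x + a k)) \<le> (2 + cmod \<alpha>) powr p * (1 + \<bar>x\<bar>) powr p" for k
    proof (rule AE_I2)
      fix x :: real
      have nz: "Im (of_real x + a k) > 0" using a[of k] d[of k] by simp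
      have "cmod (of_real x + a k) \<le> \<bar>x\<bar> + (cmod \<alpha> + 1)"
        using norm_triangle_ineq[of "of_real x" "a k"] norm_a[of k] by simp
      also have "\<dots> \<le> (2 + cmod \<alpha>) * (1 + \<bar>x\<bar>)" by (simp add: algebra_simps)
      finally have "cmod (of_real x + a k) powr p \<le> ((2 + cmod \<alpha>) * (1 + \<bar>x\<bar>)) powr p"
        using p by (intro powr_mono2) auto
      moreover have "cmod (F (of_real x + a k)) = cmod (of_real x + a k) powr p"
        using nz by (intro norm_F) (auto simp: complex_eq_iff)
      ultimately show "norm (F (of_real x + a k)) \<le> (2 + cmod \<alpha>) powr p * (1 + \<bar>x\<bar>) powr p"
        by (simp add: powr_mult)
    qed
    show "(\<lambda>x. F (of_real x + a k)) \<in> borel_measurable Q" for k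
      unfolding F_def by measurable
  qed measurable
  moreover have "(\<lambda>k. F (\<beta> + \<i> * of_real (d k))) \<longlonglongrightarrow> F \<beta>"
    using \<beta> by (intro lim_F) auto
  ultimately have "Q.expectation (\<lambda>x. exp (of_real p * L x)) = F \<beta>"
    unfolding step by (rule LIMSEQ_unique)
  then show ?thesis using \<beta> by (simp add: F_eq)
qed

lemma expectation_L: "Q.expectation L = log_br \<beta>"
  and expectation_L_square: "Q.expectation (\<lambda>x. L x ^ 2) = log_br \<beta> ^ 2"
  using Q.expectation_eq_of_exp_moments[of L "log_br \<beta>"] integrable_exp_L expectation_exp_L by auto

definition "log_mod x = ln (cmod (of_real x + \<alpha>))" for x :: real
definition "log_mod_mean = ln (cmod \<beta>)"

lemma log_mod_eq: "log_mod x = Re (L x)" by (simp add: log_mod_def L_def)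

lemma log_mod_measurable [measurable]: "log_mod \<in> borel_measurable borel"
  unfolding log_mod_eq[abs_def] by measurable

lemma integrable_L_power: "integrable Q (\<lambda>x. L x ^ k)"
  by (intro Q.integrable_power_of_exp integrable_exp_L) simp

lemma integrable_L: "integrable Q L"
  using integrable_L_power[of 1] by simp

lemma integrable_arg_square: "integrable Q (\<lambda>x. (arg_br (of_real x + \<alpha>))\<^sup>2)"
proof -
  have "(\<lambda>x::real. arg_br (of_real x + \<alpha>)) = (\<lambda>x. Im (L x))" by (simp add: L_def)
  then have [measurable]: "(\<lambda>x::real. arg_br (of_real x + \<alpha>)) \<in> borel_measurable borel" by simp
  have "AE x in Q. norm ((arg_br (of_real x + \<alpha>))\<^sup>2) \<le> pi\<^sup>2"
    using AE_Q_nonzero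
  proof eventually_elim
    fix x :: real assume "of_real x + \<alpha> \<noteq> 0"
    then show "norm ((arg_br (of_real x + \<alpha>))\<^sup>2) \<le> pi\<^sup>2"
      using Im_\<alpha> arg_br_nonneg[of "of_real x + \<alpha>"] arg_br_le_pi[of "of_real x + \<alpha>"]
      by (auto intro!: power_mono)
  qed
  then show ?thesis by (intro Q.integrable_const_bound) auto
qed

lemma expectation_log_mod: "integrable Q log_mod" "Q.expectation log_mod = log_mod_mean"
proof -
  have "integrable Q (\<lambda>x. Re (L x))" by (rule integrable_Re[OF integrable_L])
  then show "integrable Q log_mod" by (simp add: log_mod_eq[abs_def])
  have "Q.expectation log_mod = Re (Q.expectation L)"
    using integral_Re[OF integrable_L] by (simp add: log_mod_eq[abs_def])
  then show "Q.expectation log_mod = log_mod_mean" by (simp add: expectation_L log_mod_mean_def)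
qed

text \<open>Defined through the argument, the form in which the limiting variance is stated;
  \<open>variance_log_mod\<close> justifies the name.\<close>

definition "log_mod_var = Q.expectation (\<lambda>x. (arg_br (of_real x + \<alpha>))\<^sup>2) - (arg_br \<beta>)\<^sup>2"

text \<open>Since \<open>(log Y)\<^sup>2\<close> has mean \<open>(log \<beta>)\<^sup>2\<close>, the modulus and the argument of \<open>Y\<close> contribute equally to the
  variance of \<open>log Y\<close>.\<close>

lemma variance_log_mod: "integrable Q (\<lambda>x. (log_mod x - log_mod_mean)\<^sup>2)" "Q.expectation (\<lambda>x. (log_mod x - log_mod_mean)\<^sup>2) = log_mod_var"
proof -
  let ?A = "\<lambda>x. arg_br (of_real x + \<alpha>)"
  have sq: "(log_mod x)\<^sup>2 = Re (L x ^ 2) + (?A x)\<^sup>2" for x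
    by (simp add: log_mod_def L_def power2_eq_square)
  have iL: "integrable Q (\<lambda>x. Re (L x ^ 2))"
    by (intro integrable_Re integrable_L_power)
  have il2: "integrable Q (\<lambda>x. (log_mod x)\<^sup>2)"
    unfolding sq by (intro Bochner_Integration.integrable_add iL integrable_arg_square)
  have "Q.expectation (\<lambda>x. (log_mod x)\<^sup>2) = Re (Q.expectation (\<lambda>x. L x ^ 2)) + Q.expectation (\<lambda>x. (?A x)\<^sup>2)"
    unfolding sq using iL integrable_arg_square integral_Re[OF integrable_L_power[of 2]] by simp
  also have "Re (Q.expectation (\<lambda>x. L x ^ 2)) = log_mod_mean\<^sup>2 - (arg_br \<beta>)\<^sup>2"
    unfolding expectation_L_square by (simp add: power2_eq_square log_mod_mean_def)
  finally have el2: "Q.expectation (\<lambda>x. (log_mod x)\<^sup>2) = log_mod_mean\<^sup>2 + log_mod_var" by (simp add: log_mod_var_def)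
  have eq: "(log_mod x - log_mod_mean)\<^sup>2 = (log_mod x)\<^sup>2 - 2 * log_mod_mean * log_mod x + log_mod_mean\<^sup>2" for x
    by (simp add: power2_eq_square algebra_simps)
  show "integrable Q (\<lambda>x. (log_mod x - log_mod_mean)\<^sup>2)" "Q.expectation (\<lambda>x. (log_mod x - log_mod_mean)\<^sup>2) = log_mod_var"
    unfolding eq using il2 expectation_log_mod
    by (simp_all add: el2 Q.prob_space[simplified]) (simp add: power2_eq_square)
qed

end

section \<open>The moment generating function of the centred log-modulus\<close>

context shifted_cauchy
begin

text \<open>Centring splits the factor |\<beta>|^q off the absolute moments exactly and removes the
  linear term, so that the n-th power at q / n is 1 + O(1/n).\<close>

definition "log_mod_mgf t = Q.expectation (\<lambda>x. exp (t * (log_mod x - log_mod_mean)))"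

lemma integrable_exp_centered_log_mod: "integrable Q (\<lambda>x. exp (\<bar>log_mod x - log_mod_mean\<bar> / 2))"
proof -
  have "integrable Q (\<lambda>x. exp (\<bar>log_mod_mean\<bar> / 2) * exp (cmod (L x) / 2))"
    by (intro integrable_mult_right integrable_exp_L)
  then show ?thesis
  proof (rule Bochner_Integration.integrable_bound)
    have "\<bar>log_mod x - log_mod_mean\<bar> \<le> \<bar>log_mod_mean\<bar> + cmod (L x)" for x
      using abs_Re_le_cmod[of "L x"] by (simp add: log_mod_eq)
    then show "AE x in Q. norm (exp (\<bar>log_mod x - log_mod_mean\<bar> / 2)) \<le> norm (exp (\<bar>log_mod_mean\<bar> / 2) * exp (cmod (L x) / 2))"
      by (simp add: add_divide_distrib[symmetric] flip: exp_add)
  qed simp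
qed

lemma integrable_exp_log_mod: "\<bar>t\<bar> \<le> 1 / 2 \<Longrightarrow> integrable Q (\<lambda>x. exp (t * log_mod x))"
proof -
  assume t: "\<bar>t\<bar> \<le> 1 / 2"
  have "integrable Q (\<lambda>x. exp (t * log_mod_mean) * exp (t * (log_mod x - log_mod_mean)))"
    using t by (intro integrable_mult_right Q.integrable_exp_scaled_real integrable_exp_centered_log_mod) auto
  then show ?thesis by (simp add: right_diff_distrib flip: exp_add)
qed

lemma expectation_exp_log_mod: "Q.expectation (\<lambda>x. exp (t * log_mod x)) = exp (t * log_mod_mean) * log_mod_mgf t"
proof -
  have "Q.expectation (\<lambda>x. exp (t * log_mod x)) = Q.expectation (\<lambda>x. exp (t * log_mod_mean) * exp (t * (log_mod x - log_mod_mean)))"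
    by (simp add: right_diff_distrib flip: exp_add)
  then show ?thesis by (simp add: log_mod_mgf_def)
qed

text \<open>At t = q / n the expansion reads 1 + t^2 / 2 * \<open>log_mod_var\<close> + O(t^3), so
  n^2 times the excess over 1 converges and \<open>power_near_one_limit\<close> applies.\<close>

lemma log_mod_mgf_power_limit:
  assumes "q > 0"
  shows "(\<lambda>n. real n * (log_mod_mgf (q / real n) ^ n - 1)) \<longlonglongrightarrow> q\<^sup>2 / 2 * log_mod_var"
proof -
  obtain C where C: "\<And>t. 0 \<le> t \<Longrightarrow> t \<le> 1 / 4 \<Longrightarrow>
    \<bar>Q.expectation (\<lambda>x. exp (t * (log_mod x - log_mod_mean))) - (1 + t * Q.expectation (\<lambda>x. log_mod x - log_mod_mean)
      + t\<^sup>2 / 2 * Q.expectation (\<lambda>x. (log_mod x - log_mod_mean)\<^sup>2))\<bar> \<le> C * t ^ 3"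
    using Q.exp_moment_expansion_real[of "\<lambda>x. log_mod x - log_mod_mean"] integrable_exp_centered_log_mod by auto
  have "Q.expectation (\<lambda>x. log_mod x - log_mod_mean) = 0"
    using expectation_log_mod by (simp add: Q.prob_space[simplified])
  then have log_mod_mgf: "\<bar>log_mod_mgf t - (1 + t\<^sup>2 / 2 * log_mod_var)\<bar> \<le> C * t ^ 3" if "0 \<le> t" "t \<le> 1 / 4" for t
    using C[OF that] by (simp add: variance_log_mod log_mod_mgf_def)
  have "(\<lambda>n. real n ^ 2 * (log_mod_mgf (q / real n) - 1) - q\<^sup>2 / 2 * log_mod_var) \<longlonglongrightarrow> 0"
  proof (rule Lim_null_comparison)
    show "(\<lambda>n. C * q ^ 3 / real n) \<longlonglongrightarrow> 0" by real_asymp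
    have "eventually (\<lambda>n. q / real n \<le> 1 / 4) sequentially" by real_asymp
    then show "\<forall>\<^sub>F n in sequentially. norm (real n ^ 2 * (log_mod_mgf (q / real n) - 1) - q\<^sup>2 / 2 * log_mod_var) \<le> C * q ^ 3 / real n"
      using eventually_gt_at_top[of 0]
    proof eventually_elim
      case (elim n)
      have "real n ^ 2 * (log_mod_mgf (q / real n) - 1) - q\<^sup>2 / 2 * log_mod_var
          = real n ^ 2 * (log_mod_mgf (q / real n) - (1 + (q / real n)\<^sup>2 / 2 * log_mod_var))"
        using elim by (simp add: field_simps)
      also have "norm \<dots> = real n ^ 2 * \<bar>log_mod_mgf (q / real n) - (1 + (q / real n)\<^sup>2 / 2 * log_mod_var)\<bar>"
        by (simp add: abs_mult)
      also have "\<dots> \<le> real n ^ 2 * (C * (q / real n) ^ 3)"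
        using elim assms by (intro mult_left_mono log_mod_mgf) auto
      also have "\<dots> = C * q ^ 3 / real n"
        using elim by (simp add: field_simps power2_eq_square power3_eq_cube)
      finally show ?case .
    qed
  qed
  then have "(\<lambda>n. real n ^ 2 * (log_mod_mgf (q / real n) - 1)) \<longlonglongrightarrow> q\<^sup>2 / 2 * log_mod_var"
    by (simp add: LIM_zero_iff)
  from power_near_one_limit[OF this] show ?thesis by simp
qed

lemma log_mod_mgf_power_tendsto_1:
  assumes "q > 0"
  shows "(\<lambda>n. log_mod_mgf (q / real n) ^ n) \<longlonglongrightarrow> 1"
proof -
  have "(\<lambda>n. (1 / real n) * (real n * (log_mod_mgf (q / real n) ^ n - 1)) + 1) \<longlonglongrightarrow> 0 * (q\<^sup>2 / 2 * log_mod_var) + 1"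
    by (intro tendsto_add tendsto_mult tendsto_const log_mod_mgf_power_limit assms) real_asymp
  from this[unfolded mult_zero_left add_0_left] show ?thesis
    by (rule Lim_transform_eventually) (auto intro: eventually_mono[OF eventually_gt_at_top[of 0]])
qed

text \<open>On the closed upper half-plane the argument is an arccosine, and the translation x to x
  + Re \<alpha> moves the centre of the density from \<mu> to Re \<alpha> + \<mu>. The constant
  \<theta> is the argument of \<open>\<beta>\<close>.\<close>

lemma log_mod_var_eq:
  "log_mod_var = \<sigma> / pi * (\<integral>x. (arccos (x / sqrt (x\<^sup>2 + (Im \<alpha>)\<^sup>2)))\<^sup>2 / ((x - (Re \<alpha> + \<mu>))\<^sup>2 + \<sigma>\<^sup>2) \<partial>lborel)
     - (theta_const \<mu> \<sigma> \<alpha>)\<^sup>2"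
proof -
  let ?f = "\<lambda>x. (arccos (x / sqrt (x\<^sup>2 + (Im \<alpha>)\<^sup>2)))\<^sup>2 / ((x - (Re \<alpha> + \<mu>))\<^sup>2 + \<sigma>\<^sup>2)"
  let ?A = "\<lambda>x. arg_br (of_real x + \<alpha>)"
  have "(\<lambda>x::real. arg_br (of_real x + \<alpha>)) = (\<lambda>x. Im (L x))" by (simp add: L_def)
  then have [measurable]: "(\<lambda>x::real. arg_br (of_real x + \<alpha>)) \<in> borel_measurable borel" by simp
  have eq: "cauchy_density \<mu> \<sigma> x *\<^sub>R (?A x)\<^sup>2 = \<sigma> / pi * ?f (Re \<alpha> + 1 * x)"
    if "of_real x + \<alpha> \<noteq> 0" for x
  proof -
    have "?A x = arccos ((Re \<alpha> + x) / sqrt ((Re \<alpha> + x)\<^sup>2 + (Im \<alpha>)\<^sup>2))"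
      using that Im_\<alpha> by (simp add: arg_br_eq_arccos cmod_def add.commute)
    then show ?thesis by (simp add: cauchy_density_def)
  qed
  have "Q.expectation (\<lambda>x. (?A x)\<^sup>2) = (\<integral>x. cauchy_density \<mu> \<sigma> x *\<^sub>R (?A x)\<^sup>2 \<partial>lborel)"
    unfolding Q_def using \<sigma>_pos by (subst integral_cauchy_measure) auto
  also have "\<dots> = (\<integral>x. \<sigma> / pi * ?f (Re \<alpha> + 1 * x) \<partial>lborel)"
  proof (rule integral_cong_AE)
    show ae: "AE x in lborel. cauchy_density \<mu> \<sigma> x *\<^sub>R (?A x)\<^sup>2 = \<sigma> / pi * ?f (Re \<alpha> + 1 * x)"
      using AE_of_real_plus_nonzero[of \<alpha>] by eventually_elim (rule eq)
    \<comment> \<open>Measurability of the arccosine integrand is read off from that of the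
      argument: the two agree except possibly at the single zero of x + \<alpha>, which exists only
      for real \<alpha>.\<close>
    have "(\<lambda>x. \<sigma> / pi * ?f (Re \<alpha> + 1 * x)) =
        (\<lambda>x. if of_real x + \<alpha> = 0 then \<sigma> / pi * ?f 0 else cauchy_density \<mu> \<sigma> x *\<^sub>R (?A x)\<^sup>2)"
    proof
      fix x show "\<sigma> / pi * ?f (Re \<alpha> + 1 * x) =
        (if of_real x + \<alpha> = 0 then \<sigma> / pi * ?f 0 else cauchy_density \<mu> \<sigma> x *\<^sub>R (?A x)\<^sup>2)"
      proof (cases "of_real x + \<alpha> = 0")
        case True
        then have "Re \<alpha> + 1 * x = 0" by (simp add: complex_eq_iff add.commute)
        with True show ?thesis by (simp only: if_True refl)
      next
        case False
        show ?thesis by (simp only: if_not_P[OF False] eq[OF False])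
      qed
    qed
    also have "\<dots> \<in> borel_measurable lborel" by measurable
    finally show "(\<lambda>x. \<sigma> / pi * ?f (Re \<alpha> + 1 * x)) \<in> borel_measurable lborel" .
  qed measurable
  also have "\<dots> = \<sigma> / pi * (\<integral>x. ?f (Re \<alpha> + 1 * x) \<partial>lborel)"
    by (rule integral_mult_right_zero)
  also have "(\<integral>x. ?f (Re \<alpha> + 1 * x) \<partial>lborel) = (\<integral>x. ?f x \<partial>lborel)"
    using lborel_integral_real_affine[of 1 ?f "Re \<alpha>"] by simp
  finally have "Q.expectation (\<lambda>x. (?A x)\<^sup>2) = \<sigma> / pi * (\<integral>x. ?f x \<partial>lborel)" .
  moreover have "arg_br \<beta> = theta_const \<mu> \<sigma> \<alpha>"
    using \<beta> by (subst arg_br_eq_arccos) (auto simp: theta_const_def \<beta>_def cmod_def)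
  ultimately show ?thesis by (simp add: log_mod_var_def)
qed

definition "root_factor n x = pow_br (of_real x + \<alpha>) (1 / real n)" for x :: real

lemma root_factor_measurable [measurable]: "root_factor n \<in> borel_measurable borel"
proof -
  have "root_factor n = (\<lambda>x. if of_real x + \<alpha> = 0 then 0 else exp (of_real (1 / real n) * L x))"
    by (auto simp: root_factor_def pow_br_def L_def)
  also have "\<dots> \<in> borel_measurable borel" by measurable
  finally show ?thesis .
qed

lemma root_factor_eq: "of_real x + \<alpha> \<noteq> 0 \<Longrightarrow> root_factor n x = exp (of_real (1 / real n) * L x)"
  by (simp add: root_factor_def pow_br_def L_def)

text \<open>\<open>n \<ge> 2\<close> puts the exponent 1/n into the range (0, 1/2] covered by the
  exponential moments of |log Y|. The value 0 of the power at 0 changes the integrand on a null set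
  only.\<close>

lemma
  assumes "n \<ge> 2"
  shows integrable_root_factor: "integrable Q (root_factor n)"
    and expectation_root_factor: "Q.expectation (root_factor n) = exp (of_real (1 / real n) * log_br \<beta>)"
proof -
  have n: "0 < 1 / real n" "1 / real n \<le> 1 / 2" using assms by (auto simp: field_simps)
  have ae: "AE x in Q. exp (of_real (1 / real n) * L x) = root_factor n x"
    using AE_Q_nonzero by eventually_elim (rule root_factor_eq[symmetric])
  have "integrable Q (\<lambda>x. exp (of_real (1 / real n) * L x))"
    using n by (intro Q.integrable_exp_scaled integrable_exp_L) auto
  then show "integrable Q (root_factor n)"
    by (rule integrable_cong_AE_imp) (use ae in auto)
  have "Q.expectation (root_factor n) = Q.expectation (\<lambda>x. exp (of_real (1 / real n) * L x))"
    by (rule integral_cong_AE) (use ae in auto)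
  also have "\<dots> = exp (of_real (1 / real n) * log_br \<beta>)"
    by (rule expectation_exp_L[OF n])
  finally show "Q.expectation (root_factor n) = exp (of_real (1 / real n) * log_br \<beta>)" .
qed

text \<open>Off the null point, |Y^(1/n)|^q = exp((q/n) log |Y|), and
  \<open>real n \<ge> 2 * q\<close> keeps the rate q/n at most 1/2.\<close>

lemma
  assumes "q > 0" "real n \<ge> 2 * q"
  shows integrable_root_factor_powr: "integrable Q (\<lambda>x. cmod (root_factor n x) powr q)"
    and expectation_root_factor_powr: "Q.expectation (\<lambda>x. cmod (root_factor n x) powr q) = exp (q / real n * log_mod_mean) * log_mod_mgf (q / real n)"
proof -
  have n: "\<bar>q / real n\<bar> \<le> 1 / 2" using assms by (auto simp: field_simps)
  have ae: "AE x in Q. exp (q / real n * log_mod x) = cmod (root_factor n x) powr q"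
    using AE_Q_nonzero
    by eventually_elim (simp add: root_factor_eq log_mod_eq powr_def)
  show "integrable Q (\<lambda>x. cmod (root_factor n x) powr q)"
    by (rule integrable_cong_AE_imp[OF integrable_exp_log_mod[OF n]]) (use ae in auto)
  have "Q.expectation (\<lambda>x. cmod (root_factor n x) powr q) = Q.expectation (\<lambda>x. exp (q / real n * log_mod x))"
    by (rule integral_cong_AE) (use ae in auto)
  then show "Q.expectation (\<lambda>x. cmod (root_factor n x) powr q) = exp (q / real n * log_mod_mean) * log_mod_mgf (q / real n)"
    by (simp only: expectation_exp_log_mod)
qed

end

section \<open>The geometric mean of a sample\<close>

locale shifted_cauchy_sample = shifted_cauchy \<mu> \<sigma> \<alpha> + prob_space M
  for \<mu> \<sigma> \<alpha> and M :: "'a measure" +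
  fixes X :: "nat \<Rightarrow> 'a \<Rightarrow> real"
  assumes indep: "indep_vars (\<lambda>_. borel) X {1..}"
    and dist_X: "\<And>i. i \<ge> 1 \<Longrightarrow> distributed M lborel (X i) (\<lambda>x. ennreal (cauchy_density \<mu> \<sigma> x))"
begin

lemma X_measurable: "i \<ge> 1 \<Longrightarrow> X i \<in> borel_measurable M"
  using indep by (auto simp: indep_vars_def)

lemma distr_X: "i \<ge> 1 \<Longrightarrow> distr M borel (X i) = Q"
  using distributed_distr_eq_density[OF dist_X] by (simp add: Q_def cauchy_measure_def cong: distr_cong)

lemma AE_X: "AE x in Q. R x \<Longrightarrow> i \<ge> 1 \<Longrightarrow> AE \<omega> in M. R (X i \<omega>)"
  unfolding distr_X[symmetric] by (rule AE_distrD) (auto intro: X_measurable)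

lemma
  fixes f :: "real \<Rightarrow> 'b::{banach, second_countable_topology}"
  assumes "i \<ge> 1" "f \<in> borel_measurable borel"
  shows integrable_X: "integrable M (\<lambda>\<omega>. f (X i \<omega>)) \<longleftrightarrow> integrable Q f"
    and integral_X: "expectation (\<lambda>\<omega>. f (X i \<omega>)) = Q.expectation f"
  unfolding distr_X[OF assms(1), symmetric] using assms X_measurable
  by (auto simp: integrable_distr_eq integral_distr)

lemma
  fixes f :: "real \<Rightarrow> 'b::{real_normed_field, banach, second_countable_topology}"
  assumes [measurable]: "f \<in> borel_measurable borel" and "integrable Q f"
  shows integrable_prod_X: "integrable M (\<lambda>\<omega>. \<Prod>j=1..n. f (X j \<omega>))"
    and expectation_prod_X: "expectation (\<lambda>\<omega>. \<Prod>j=1..n. f (X j \<omega>)) = Q.expectation f ^ n"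
proof -
  have "indep_vars (\<lambda>_. borel) X {1..n}"
    by (rule indep_vars_subset[OF indep]) auto
  then have ind: "indep_vars (\<lambda>_. borel) (\<lambda>j \<omega>. f (X j \<omega>)) {1..n}"
    by (rule indep_vars_compose2) simp
  have int: "integrable M (\<lambda>\<omega>. f (X j \<omega>))" if "j \<in> {1..n}" for j
    using that assms by (subst integrable_X) auto
  show "integrable M (\<lambda>\<omega>. \<Prod>j=1..n. f (X j \<omega>))"
    by (rule indep_vars_integrable[OF _ ind int]) auto
  have "expectation (\<lambda>\<omega>. \<Prod>j=1..n. f (X j \<omega>)) = (\<Prod>j=1..n. expectation (\<lambda>\<omega>. f (X j \<omega>)))"
    by (rule indep_vars_lebesgue_integral[OF _ ind int]) auto
  also have "\<dots> = (\<Prod>j=1..n. Q.expectation f)"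
    by (intro prod.cong integral_X) auto
  finally show "expectation (\<lambda>\<omega>. \<Prod>j=1..n. f (X j \<omega>)) = Q.expectation f ^ n" by simp
qed

text \<open>The estimator without the final shift by \<alpha>: a product of independent factors with
  the same law, with target \<open>\<beta>\<close>.\<close>

definition "geo_prod n \<omega> = (\<Prod>j=1..n. root_factor n (X j \<omega>))"

lemma geo_est_eq: "geo_est \<alpha> X n \<omega> = geo_prod n \<omega> - \<alpha>"
  by (simp add: geo_est_def geo_prod_def root_factor_def)

lemma geo_prod_measurable [measurable]: "geo_prod n \<in> borel_measurable M"
  unfolding geo_prod_def[abs_def] using X_measurable
  by (intro borel_measurable_prod measurable_compose[OF _ root_factor_measurable]) auto

text \<open>Independence turns the mean of the product into the n-th power of exp(log \<beta> / n),
  which is exp(log \<beta>) = \<beta>.\<close>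

lemma
  assumes "n \<ge> 2"
  shows integrable_geo_prod: "integrable M (geo_prod n)" and expectation_geo_prod: "expectation (geo_prod n) = \<beta>"
proof -
  show "integrable M (geo_prod n)"
    unfolding geo_prod_def[abs_def] by (intro integrable_prod_X integrable_root_factor assms) simp
  have "expectation (geo_prod n) = Q.expectation (root_factor n) ^ n"
    unfolding geo_prod_def[abs_def] by (intro expectation_prod_X integrable_root_factor assms) simp
  also have "\<dots> = exp (log_br \<beta>)"
    using assms by (simp add: expectation_root_factor flip: exp_of_nat_mult)
  finally show "expectation (geo_prod n) = \<beta>" using \<beta> by (simp add: exp_log_br)
qed

lemma cmod_geo_prod_powr: "cmod (geo_prod n \<omega>) powr q = (\<Prod>j=1..n. cmod (root_factor n (X j \<omega>)) powr q)"
  unfolding geo_prod_def prod_norm[symmetric] by (rule prod_powr_distrib)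

lemma
  assumes "q > 0" "real n \<ge> 2 * q"
  shows integrable_geo_prod_powr: "integrable M (\<lambda>\<omega>. cmod (geo_prod n \<omega>) powr q)"
    and expectation_geo_prod_powr: "expectation (\<lambda>\<omega>. cmod (geo_prod n \<omega>) powr q) = cmod \<beta> powr q * log_mod_mgf (q / real n) ^ n"
proof -
  show "integrable M (\<lambda>\<omega>. cmod (geo_prod n \<omega>) powr q)"
    unfolding cmod_geo_prod_powr by (intro integrable_prod_X integrable_root_factor_powr assms) measurable
  have "n > 0" using assms by (cases n) auto
  have "expectation (\<lambda>\<omega>. cmod (geo_prod n \<omega>) powr q) = Q.expectation (\<lambda>x. cmod (root_factor n x) powr q) ^ n"
    unfolding cmod_geo_prod_powr by (intro expectation_prod_X integrable_root_factor_powr assms) measurable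
  also have "\<dots> = exp (q * log_mod_mean) * log_mod_mgf (q / real n) ^ n"
    using \<open>n > 0\<close> unfolding expectation_root_factor_powr[OF assms]
    by (simp add: power_mult_distrib flip: exp_of_nat_mult)
  also have "exp (q * log_mod_mean) = cmod \<beta> powr q"
    using \<beta> by (simp add: log_mod_mean_def powr_def)
  finally show "expectation (\<lambda>\<omega>. cmod (geo_prod n \<omega>) powr q) = cmod \<beta> powr q * log_mod_mgf (q / real n) ^ n" .
qed

text \<open>Off the null event that some X_j + \<alpha> vanishes, the product of the n-th roots is
  exactly exp of the average of the logarithms: the roots are taken before multiplying, so no
  multiple of 2 pi has to be tracked. The real strong law is applied to real and imaginary
  parts.\<close>

lemma AE_geo_prod_tendsto: "AE \<omega> in M. (\<lambda>n. geo_prod n \<omega>) \<longlonglongrightarrow> \<beta>"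
proof -
  define b where "b = log_br \<beta>"
  \<comment> \<open>Stated for any centred \<open>h\<close> dominated by |L - b|, to cover both
    parts with one check of the exponential moment.\<close>
  have law: "AE \<omega> in M. (\<lambda>n. (\<Sum>j=1..n. h (X j \<omega>)) / real n) \<longlonglongrightarrow> 0"
    if [measurable]: "h \<in> borel_measurable borel" and le: "\<And>x. \<bar>h x\<bar> \<le> cmod (L x - b)"
      and mean: "Q.expectation h = 0" for h
  proof (rule strong_law_exp_moment[OF indep distr_X])
    have "integrable Q (\<lambda>x. exp (cmod b / 2) * exp (cmod (L x) / 2))"
      by (intro integrable_mult_right integrable_exp_L)
    then show "integrable Q (\<lambda>x. exp (\<bar>h x\<bar> / 2))"
    proof (rule Bochner_Integration.integrable_bound)
      have "\<bar>h x\<bar> \<le> cmod b + cmod (L x)" for x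
        using le[of x] norm_triangle_ineq4[of "L x" b] by linarith
      then show "AE x in Q. norm (exp (\<bar>h x\<bar> / 2)) \<le> norm (exp (cmod b / 2) * exp (cmod (L x) / 2))"
        by (simp add: add_divide_distrib[symmetric] flip: exp_add)
    qed simp
  qed (use mean in auto)
  have intD: "integrable Q (\<lambda>x. L x - b)"
    by (intro Bochner_Integration.integrable_diff integrable_L) simp
  have meanD: "Q.expectation (\<lambda>x. L x - b) = 0"
    using integrable_L by (simp add: expectation_L b_def Q.prob_space[simplified])
  have "AE \<omega> in M. (\<lambda>n. (\<Sum>j=1..n. Re (L (X j \<omega>) - b)) / real n) \<longlonglongrightarrow> 0"
    using integral_Re[OF intD] meanD by (intro law) (auto simp del: minus_complex.simps simp: abs_Re_le_cmod)
  moreover have "AE \<omega> in M. (\<lambda>n. (\<Sum>j=1..n. Im (L (X j \<omega>) - b)) / real n) \<longlonglongrightarrow> 0"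
    using integral_Im[OF intD] meanD by (intro law) (auto simp del: minus_complex.simps simp: abs_Im_le_cmod)
  moreover have "AE \<omega> in M. \<forall>j. j \<ge> 1 \<longrightarrow> of_real (X j \<omega>) + \<alpha> \<noteq> 0"
    unfolding AE_all_countable using AE_X[OF AE_Q_nonzero] by (auto simp: AE_impI)
  ultimately show ?thesis
  proof eventually_elim
    case (elim \<omega>)
    have "(\<lambda>n. Complex ((\<Sum>j=1..n. Re (L (X j \<omega>) - b)) / real n) ((\<Sum>j=1..n. Im (L (X j \<omega>) - b)) / real n)) \<longlonglongrightarrow> Complex 0 0"
      using elim(1,2) by (rule tendsto_Complex)
    moreover have mean_eq: "Complex ((\<Sum>j=1..n. Re (L (X j \<omega>) - b)) / real n) ((\<Sum>j=1..n. Im (L (X j \<omega>) - b)) / real n)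
        = (\<Sum>j=1..n. L (X j \<omega>) - b) / of_nat n" for n
      by (simp add: complex_eq_iff Re_divide_of_nat Im_divide_of_nat)
    ultimately have "(\<lambda>n. exp ((\<Sum>j=1..n. L (X j \<omega>) - b) / of_nat n + b)) \<longlonglongrightarrow> exp (Complex 0 0 + b)"
      unfolding mean_eq
      by (intro tendsto_intros)
    then have "(\<lambda>n. exp ((\<Sum>j=1..n. L (X j \<omega>) - b) / of_nat n + b)) \<longlonglongrightarrow> \<beta>"
      using \<beta> by (simp add: b_def exp_log_br flip: zero_complex.code)
    moreover have "eventually (\<lambda>n. exp ((\<Sum>j=1..n. L (X j \<omega>) - b) / of_nat n + b) = geo_prod n \<omega>) sequentially"
      using eventually_gt_at_top[of 0]
    proof eventually_elim
      fix n :: nat assume n: "n > 0"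
      have "geo_prod n \<omega> = exp (\<Sum>j=1..n. of_real (1 / real n) * L (X j \<omega>))"
        unfolding geo_prod_def using elim(3) by (subst exp_sum) (simp, intro prod.cong root_factor_eq refl, simp)
      also have "(\<Sum>j=1..n. of_real (1 / real n) * L (X j \<omega>)) = (\<Sum>j=1..n. L (X j \<omega>) - b) / of_nat n + b"
        using n by (simp add: sum_subtractf sum_divide_distrib[symmetric] field_simps flip: sum_distrib_left)
      finally show "exp ((\<Sum>j=1..n. L (X j \<omega>) - b) / of_nat n + b) = geo_prod n \<omega>" by simp
    qed
    ultimately show ?case by (rule Lim_transform_eventually)
  qed
qed

section \<open>Convergence in \<open>L^p\<close> and the variance\<close>

lemma cmod_geo_prod_minus_powr_le:
  assumes "q > 0"
  shows "cmod (geo_prod n \<omega> - \<beta>) powr q \<le> 2 powr q * (cmod (geo_prod n \<omega>) powr q + cmod \<beta> powr q)"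
proof -
  \<comment> \<open>Twice the maximum, rather than convexity of the power, gives one bound for all q
    > 0, including q < 1.\<close>
  have "cmod (geo_prod n \<omega> - \<beta>) \<le> 2 * max (cmod (geo_prod n \<omega>)) (cmod \<beta>)"
    using norm_triangle_ineq4[of "geo_prod n \<omega>" \<beta>] by simp
  then have "cmod (geo_prod n \<omega> - \<beta>) powr q \<le> (2 * max (cmod (geo_prod n \<omega>)) (cmod \<beta>)) powr q"
    using assms by (intro powr_mono2) auto
  also have "\<dots> = 2 powr q * (max (cmod (geo_prod n \<omega>)) (cmod \<beta>)) powr q"
    by (simp add: powr_mult)
  also have "\<dots> \<le> 2 powr q * (cmod (geo_prod n \<omega>) powr q + cmod \<beta> powr q)"
    by (intro mult_left_mono) (auto simp: max_def)
  finally show ?thesis .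
qed

lemma
  assumes "q > 0" "real n \<ge> 2 * q"
  shows integrable_geo_prod_minus_powr: "integrable M (\<lambda>\<omega>. cmod (geo_prod n \<omega> - \<beta>) powr q)"
    and expectation_geo_prod_minus_powr_le: "expectation (\<lambda>\<omega>. cmod (geo_prod n \<omega> - \<beta>) powr q)
      \<le> 2 powr q * cmod \<beta> powr q * (log_mod_mgf (q / real n) ^ n + 1)"
proof -
  have int: "integrable M (\<lambda>\<omega>. 2 powr q * (cmod (geo_prod n \<omega>) powr q + cmod \<beta> powr q))"
    by (intro integrable_mult_right Bochner_Integration.integrable_add integrable_geo_prod_powr assms) simp
  then show "integrable M (\<lambda>\<omega>. cmod (geo_prod n \<omega> - \<beta>) powr q)"
    by (rule Bochner_Integration.integrable_bound) (use cmod_geo_prod_minus_powr_le[OF assms(1)] in auto)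
  then have "expectation (\<lambda>\<omega>. cmod (geo_prod n \<omega> - \<beta>) powr q)
      \<le> expectation (\<lambda>\<omega>. 2 powr q * (cmod (geo_prod n \<omega>) powr q + cmod \<beta> powr q))"
    using int cmod_geo_prod_minus_powr_le[OF assms(1)] by (intro integral_mono) auto
  also have "\<dots> = 2 powr q * cmod \<beta> powr q * (log_mod_mgf (q / real n) ^ n + 1)"
    using integrable_geo_prod_powr[OF assms] by (simp add: expectation_geo_prod_powr[OF assms] prob_space algebra_simps)
  finally show "expectation (\<lambda>\<omega>. cmod (geo_prod n \<omega> - \<beta>) powr q)
      \<le> 2 powr q * cmod \<beta> powr q * (log_mod_mgf (q / real n) ^ n + 1)" .
qed

lemma eventually_ge_real: "eventually (\<lambda>n. real n \<ge> c) sequentially"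
  by real_asymp

lemma Lp_convergence:
  assumes "p > 0"
  shows "(\<lambda>n. expectation (\<lambda>\<omega>. cmod (geo_prod n \<omega> - \<beta>) powr p)) \<longlonglongrightarrow> 0"
proof (rule expectation_tendsto_0_of_bounded_square)
  show "AE \<omega> in M. (\<lambda>n. cmod (geo_prod n \<omega> - \<beta>) powr p) \<longlonglongrightarrow> 0"
    using AE_geo_prod_tendsto
  proof eventually_elim
    case (elim \<omega>)
    then have "(\<lambda>n. cmod (geo_prod n \<omega> - \<beta>)) \<longlonglongrightarrow> 0"
      by (simp add: tendsto_norm_zero_iff LIM_zero_iff)
    then show ?case using assms
      by (intro tendsto_zero_powrI[where b=p]) auto
  qed
  have sq: "(cmod (geo_prod n \<omega> - \<beta>) powr p)\<^sup>2 = cmod (geo_prod n \<omega> - \<beta>) powr (2 * p)" for n \<omega>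
    by (simp add: power2_eq_square flip: powr_add)
  have p2: "2 * p > 0" using assms by simp
  \<comment> \<open>The squares of the p-th powers are moments of order 2 p. The n-th power of the
    generating function tends to 1, hence is eventually below 2, and 2 + 1 is the factor 3 in the
    bound.\<close>
  have "eventually (\<lambda>n. log_mod_mgf (2 * p / real n) ^ n < 2) sequentially"
    by (rule order_tendstoD[OF log_mod_mgf_power_tendsto_1[OF p2]]) simp
  then show "\<forall>\<^sub>F n in sequentially. integrable M (\<lambda>\<omega>. (cmod (geo_prod n \<omega> - \<beta>) powr p)\<^sup>2) \<and>
      expectation (\<lambda>\<omega>. (cmod (geo_prod n \<omega> - \<beta>) powr p)\<^sup>2) \<le> 2 powr (2 * p) * cmod \<beta> powr (2 * p) * 3"
    using eventually_ge_real[of "2 * (2 * p)"]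
  proof eventually_elim
    case (elim n)
    have "2 powr (2 * p) * cmod \<beta> powr (2 * p) * (log_mod_mgf (2 * p / real n) ^ n + 1)
        \<le> 2 powr (2 * p) * cmod \<beta> powr (2 * p) * 3"
      using elim by (intro mult_left_mono) auto
    then show ?case
      using integrable_geo_prod_minus_powr[OF p2 elim(2)] expectation_geo_prod_minus_powr_le[OF p2 elim(2)]
      unfolding sq by linarith
  qed
qed auto

text \<open>Since the product has mean \<open>\<beta>\<close>, its mean squared distance from
  \<open>\<beta>\<close> is E|G + \<alpha>|^2 - |\<beta>|^2, and the first term is explicit.
  \<open>n \<ge> 4\<close> is the condition n \<ge> 2 q for q = 2.\<close>

lemma
  assumes "n \<ge> 4"
  shows integrable_geo_prod_minus_square: "integrable M (\<lambda>\<omega>. (cmod (geo_prod n \<omega> - \<beta>))\<^sup>2)"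
    and expectation_geo_prod_minus_square:
      "expectation (\<lambda>\<omega>. (cmod (geo_prod n \<omega> - \<beta>))\<^sup>2) = (cmod \<beta>)\<^sup>2 * (log_mod_mgf (2 / real n) ^ n - 1)"
proof -
  have n: "(2::real) > 0" "real n \<ge> 2 * 2" using assms by auto
  have powr2: "(cmod z)\<^sup>2 = cmod z powr 2" for z by (simp add: powr_numeral)
  have i2: "integrable M (\<lambda>\<omega>. (cmod (geo_prod n \<omega>))\<^sup>2)"
    unfolding powr2 by (rule integrable_geo_prod_powr[OF n])
  have e2: "expectation (\<lambda>\<omega>. (cmod (geo_prod n \<omega>))\<^sup>2) = (cmod \<beta>)\<^sup>2 * log_mod_mgf (2 / real n) ^ n"
    unfolding powr2 by (rule expectation_geo_prod_powr[OF n])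
  have iP: "integrable M (geo_prod n)" "expectation (geo_prod n) = \<beta>"
    using assms by (auto intro: integrable_geo_prod expectation_geo_prod)
  have iR: "integrable M (\<lambda>\<omega>. Re (geo_prod n \<omega> * cnj \<beta>))"
    by (intro integrable_Re integrable_mult_left iP)
  have eR: "expectation (\<lambda>\<omega>. Re (geo_prod n \<omega> * cnj \<beta>)) = (cmod \<beta>)\<^sup>2"
  proof -
    have "expectation (\<lambda>\<omega>. Re (geo_prod n \<omega> * cnj \<beta>)) = Re (expectation (\<lambda>\<omega>. geo_prod n \<omega> * cnj \<beta>))"
      by (intro integral_Re integrable_mult_left iP)
    also have "\<dots> = Re (\<beta> * cnj \<beta>)" by (simp add: iP)
    also have "\<beta> * cnj \<beta> = of_real ((cmod \<beta>)\<^sup>2)" by (rule complex_norm_square[symmetric])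
    finally show ?thesis by (simp only: Re_complex_of_real)
  qed
  have eq: "(cmod (geo_prod n \<omega> - \<beta>))\<^sup>2 = (cmod (geo_prod n \<omega>))\<^sup>2 - 2 * Re (geo_prod n \<omega> * cnj \<beta>) + (cmod \<beta>)\<^sup>2" for \<omega>
    unfolding cmod_power2 by (simp add: power2_eq_square algebra_simps)
  show "integrable M (\<lambda>\<omega>. (cmod (geo_prod n \<omega> - \<beta>))\<^sup>2)"
    unfolding eq using i2 iR by (intro Bochner_Integration.integrable_add Bochner_Integration.integrable_diff integrable_mult_right) auto
  have "expectation (\<lambda>\<omega>. (cmod (geo_prod n \<omega> - \<beta>))\<^sup>2)
      = expectation (\<lambda>\<omega>. (cmod (geo_prod n \<omega>))\<^sup>2) - 2 * expectation (\<lambda>\<omega>. Re (geo_prod n \<omega> * cnj \<beta>)) + (cmod \<beta>)\<^sup>2"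
    unfolding eq using i2 iR by (simp add: prob_space del: times_complex.simps)
  then show "expectation (\<lambda>\<omega>. (cmod (geo_prod n \<omega> - \<beta>))\<^sup>2) = (cmod \<beta>)\<^sup>2 * (log_mod_mgf (2 / real n) ^ n - 1)"
    unfolding e2 eR by (simp add: algebra_simps)
qed

lemma geo_est_minus: "geo_est \<alpha> X n \<omega> - Complex \<mu> \<sigma> = geo_prod n \<omega> - \<beta>"
  by (simp add: geo_est_eq \<beta>_def)

lemma
  assumes "n \<ge> 2"
  shows integrable_geo_est: "integrable M (geo_est \<alpha> X n)"
    and expectation_geo_est: "expectation (geo_est \<alpha> X n) = Complex \<mu> \<sigma>"
  unfolding geo_est_eq[abs_def] using integrable_geo_prod[OF assms] expectation_geo_prod[OF assms]
  by (auto simp: prob_space \<beta>_def)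

lemma variance_limit:
  "(\<lambda>n. real n * complex_variance M (geo_est \<alpha> X n)) \<longlonglongrightarrow> 2 * (cmod \<beta>)\<^sup>2 * log_mod_var"
proof -
  \<comment> \<open>The limit for q = 2; its factor 2^2 / 2 is the leading 2 of the asymptotic
    variance.\<close>
  have "(\<lambda>n. (cmod \<beta>)\<^sup>2 * (real n * (log_mod_mgf (2 / real n) ^ n - 1))) \<longlonglongrightarrow> (cmod \<beta>)\<^sup>2 * (2\<^sup>2 / 2 * log_mod_var)"
    by (intro tendsto_mult tendsto_const log_mod_mgf_power_limit) simp
  then have "(\<lambda>n. (cmod \<beta>)\<^sup>2 * (real n * (log_mod_mgf (2 / real n) ^ n - 1))) \<longlonglongrightarrow> 2 * (cmod \<beta>)\<^sup>2 * log_mod_var"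
    by (simp add: mult_ac)
  then show ?thesis
  proof (rule Lim_transform_eventually)
    show "\<forall>\<^sub>F n in sequentially. (cmod \<beta>)\<^sup>2 * (real n * (log_mod_mgf (2 / real n) ^ n - 1))
        = real n * complex_variance M (geo_est \<alpha> X n)"
      using eventually_ge_at_top[of 4]
      by eventually_elim
        (simp add: complex_variance_def expectation_geo_est geo_est_minus expectation_geo_prod_minus_square)
  qed
qed

end

theorem theorem4p2:
  fixes M :: "'a measure" and X :: "nat \<Rightarrow> 'a \<Rightarrow> real"
    and \<mu> \<sigma> :: real and \<alpha> :: complex
  assumes "prob_space M"
    and "\<sigma> > 0"
    and "prob_space.indep_vars M (\<lambda>_. borel) X {1..}"
    and "\<And>i. i \<ge> 1 \<Longrightarrow> distributed M lborel (X i) (\<lambda>x. ennreal (cauchy_density \<mu> \<sigma> x))"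
    and "Im \<alpha> \<ge> 0"
  shows
    "(\<forall>n\<ge>2. integrable M (geo_est \<alpha> X n) \<and>
        integral\<^sup>L M (geo_est \<alpha> X n) = Complex \<mu> \<sigma>) \<and>
     (AE \<omega> in M. (\<lambda>n. geo_est \<alpha> X n \<omega>) \<longlonglongrightarrow> Complex \<mu> \<sigma>) \<and>
     (\<forall>p::real. p > 0 \<longrightarrow>
        (\<forall>\<^sub>F n in sequentially.
           integrable M (\<lambda>\<omega>. cmod (geo_est \<alpha> X n \<omega> - Complex \<mu> \<sigma>) powr p)) \<and>
        (\<lambda>n. integral\<^sup>L M (\<lambda>\<omega>. cmod (geo_est \<alpha> X n \<omega> - Complex \<mu> \<sigma>) powr p))
          \<longlonglongrightarrow> 0) \<and>
     (\<forall>\<^sub>F n in sequentially. integrable M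
        (\<lambda>\<omega>. (cmod (geo_est \<alpha> X n \<omega> - integral\<^sup>L M (geo_est \<alpha> X n)))\<^sup>2)) \<and>
     (\<lambda>n. real n * complex_variance M (geo_est \<alpha> X n)) \<longlonglongrightarrow>
       2 * ((\<mu> + Re \<alpha>)\<^sup>2 + (\<sigma> + Im \<alpha>)\<^sup>2) *
       (\<sigma> / pi * (\<integral>x. (arccos (x / sqrt (x\<^sup>2 + (Im \<alpha>)\<^sup>2)))\<^sup>2
                      / ((x - (Re \<alpha> + \<mu>))\<^sup>2 + \<sigma>\<^sup>2) \<partial>lborel)
         - (theta_const \<mu> \<sigma> \<alpha>)\<^sup>2)"
proof -
  interpret prob_space M by fact
  interpret shifted_cauchy_sample \<mu> \<sigma> \<alpha> M X
    by unfold_locales (use assms in auto)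
  have "AE \<omega> in M. (\<lambda>n. geo_est \<alpha> X n \<omega>) \<longlonglongrightarrow> Complex \<mu> \<sigma>"
    using AE_geo_prod_tendsto
  proof eventually_elim
    case (elim \<omega>)
    then have "(\<lambda>n. geo_prod n \<omega> - \<alpha>) \<longlonglongrightarrow> \<beta> - \<alpha>" by (intro tendsto_intros)
    then show ?case by (simp add: geo_est_eq \<beta>_def)
  qed
  moreover have "\<forall>\<^sub>F n in sequentially. integrable M (\<lambda>\<omega>. cmod (geo_est \<alpha> X n \<omega> - Complex \<mu> \<sigma>) powr p)"
    if "p > 0" for p
    using eventually_ge_real[of "2 * p"]
    by eventually_elim (simp add: geo_est_minus integrable_geo_prod_minus_powr that)
  moreover have "\<forall>\<^sub>F n in sequentially. integrable M
      (\<lambda>\<omega>. (cmod (geo_est \<alpha> X n \<omega> - integral\<^sup>L M (geo_est \<alpha> X n)))\<^sup>2)"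
    using eventually_ge_at_top[of 4]
    by eventually_elim (simp add: expectation_geo_est geo_est_minus integrable_geo_prod_minus_square)
  moreover have "(cmod \<beta>)\<^sup>2 = (\<mu> + Re \<alpha>)\<^sup>2 + (\<sigma> + Im \<alpha>)\<^sup>2"
    by (simp add: \<beta>_def cmod_power2)
  ultimately show ?thesis
    using integrable_geo_est expectation_geo_est Lp_convergence variance_limit
    unfolding geo_est_minus log_mod_var_eq by simp
qed

end
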